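(* Let $n\ge3$ and $m\ge2n$. Then $\overline{L_P^2\cdot\mathsf p}$ is not normal.
   Context: All varieties are over $\mathbb C$. Let $\mathfrak v$ be a complex vector space of dimension $m$ with basis $e_1,\dots,e_m$, $E=\operatorname{End}\mathfrak v$ (identified with $m\times m$ matrices $X=(x_{i,j})$), with basis of matrix units $e_{i,j}=e_i\otimes e_j^*$; $G=\operatorname{GL}(E)$, and $Q=S^m(E^* )$, the homogeneous polynomial functions of degree $m$ on $E$, with $G$ acting by $(g\cdot q)(X)=q(g^{-1}X)$. Define $\mathsf p\in Q$ by $\mathsf p(X)=x_{1,1}^{m-n}\operatorname{perm}(X^o)$, where $X^o=(x_{i,j})_{m-n+1\le i,j\le m}$ and $\operatorname{perm}$ is the permanent. Let $S\subset E$ be the span of $e_{1,1}$ and all $e_{i,j}$ with $m-n+1\le i,j\le m$, and $S^\perp$ the span of the remaining $e_{i,j}$. $L_P^2=\operatorname{GL}(S)$, viewed as a subgroup of $G$ acting as the identity on $S^\perp$. $\overline{L_P^2\cdot\mathsf p}$ is the Zariski closure in $Q$ (reduced). *)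

theory Defs
  imports
    "HOL-Analysis.Analysis"
    "HOL-Algebra.Polynomials"
    "HOL-Library.Function_Algebras"
begin

section \<open>Integrally closed domains\<close>

definition frac_rel :: "('a, 'b) ring_scheme \<Rightarrow> (('a \<times> 'a) \<times> ('a \<times> 'a)) set" where
  "frac_rel R = {((a, b), (c, d)).
     a \<in> carrier R \<and> b \<in> carrier R - {\<zero>\<^bsub>R\<^esub>} \<and>
     c \<in> carrier R \<and> d \<in> carrier R - {\<zero>\<^bsub>R\<^esub>} \<and>
     a \<otimes>\<^bsub>R\<^esub> d = c \<otimes>\<^bsub>R\<^esub> b}"

definition fraction :: "('a, 'b) ring_scheme \<Rightarrow> 'a \<Rightarrow> 'a \<Rightarrow> ('a \<times> 'a) set" where
  "fraction R a b = frac_rel R `` {(a, b)}"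

text \<open>The unions below range over all representatives of the two classes; for a domain
  all the classes united are equal (see \<open>fraction_mult\<close> and \<open>fraction_add\<close>).\<close>

definition frac_field :: "('a, 'b) ring_scheme \<Rightarrow> ('a \<times> 'a) set ring" where
  "frac_field R = \<lparr>
     carrier = (carrier R \<times> (carrier R - {\<zero>\<^bsub>R\<^esub>})) // frac_rel R,
     mult = (\<lambda>x y. \<Union>(a, b) \<in> x. \<Union>(c, d) \<in> y. fraction R (a \<otimes>\<^bsub>R\<^esub> c) (b \<otimes>\<^bsub>R\<^esub> d)),
     one = fraction R \<one>\<^bsub>R\<^esub> \<one>\<^bsub>R\<^esub>,
     zero = fraction R \<zero>\<^bsub>R\<^esub> \<one>\<^bsub>R\<^esub>,
     add = (\<lambda>x y. \<Union>(a, b) \<in> x. \<Union>(c, d) \<in> y.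
              fraction R ((a \<otimes>\<^bsub>R\<^esub> d) \<oplus>\<^bsub>R\<^esub> (c \<otimes>\<^bsub>R\<^esub> b)) (b \<otimes>\<^bsub>R\<^esub> d))\<rparr>"

definition to_frac :: "('a, 'b) ring_scheme \<Rightarrow> 'a \<Rightarrow> ('a \<times> 'a) set" where
  "to_frac R a = fraction R a \<one>\<^bsub>R\<^esub>"

text \<open>Polynomials are coefficient lists with the leading coefficient first, so
  \<open>hd p = \<one>\<close> says that \<open>p\<close> is monic.\<close>

definition integral_over :: "('a, 'b) ring_scheme \<Rightarrow> 'a set \<Rightarrow> 'a \<Rightarrow> bool" where
  "integral_over K A x \<longleftrightarrow> x \<in> carrier K \<and>
     (\<exists>p. p \<noteq> [] \<and> polynomial\<^bsub>K\<^esub> A p \<and> hd p = \<one>\<^bsub>K\<^esub> \<and> ring.eval K p x = \<zero>\<^bsub>K\<^esub>)"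

definition integrally_closed_domain :: "('a, 'b) ring_scheme \<Rightarrow> bool" where
  "integrally_closed_domain R \<longleftrightarrow> domain R \<and>
     (\<forall>x. integral_over (frac_field R) (to_frac R ` carrier R) x \<longrightarrow> x \<in> to_frac R ` carrier R)"

lemma UN_pairs_const:
  assumes "\<And>a b c d. (a, b) \<in> x \<Longrightarrow> (c, d) \<in> y \<Longrightarrow> G a b c d = F" "x \<noteq> {}" "y \<noteq> {}"
  shows "(\<Union>(a, b) \<in> x. \<Union>(c, d) \<in> y. G a b c d) = F"
proof -
  have "(\<Union>(a, b) \<in> x. \<Union>(c, d) \<in> y. G a b c d) = (\<Union>p \<in> x. \<Union>q \<in> y. F)"
    using assms(1) by (intro SUP_cong refl) (auto intro!: SUP_cong split: prod.splits)
  then show ?thesis using assms(2,3) by simp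
qed

context domain
begin

lemma frac_relD:
  assumes "((a, b), (c, d)) \<in> frac_rel R"
  shows "a \<in> carrier R" "b \<in> carrier R" "b \<noteq> \<zero>" "c \<in> carrier R" "d \<in> carrier R" "d \<noteq> \<zero>"
    "a \<otimes> d = c \<otimes> b"
  using assms by (auto simp: frac_rel_def)

lemma equiv_frac_rel: "equiv (carrier R \<times> (carrier R - {\<zero>})) (frac_rel R)"
proof (rule equivI)
  show "frac_rel R \<subseteq> (carrier R \<times> (carrier R - {\<zero>})) \<times> (carrier R \<times> (carrier R - {\<zero>}))"
    by (auto simp: frac_rel_def)
  show "refl_on (carrier R \<times> (carrier R - {\<zero>})) (frac_rel R)"
    by (auto simp: refl_on_def frac_rel_def)
  show "sym (frac_rel R)"
    by (auto simp: sym_def frac_rel_def)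
  show "trans (frac_rel R)"
  proof (rule transI, clarify)
    fix a b c d e f
    assume *: "((a, b), (c, d)) \<in> frac_rel R" "((c, d), (e, f)) \<in> frac_rel R"
    note c = frac_relD[OF *(1)] frac_relD[OF *(2)]
    have "d \<otimes> (a \<otimes> f) = (a \<otimes> d) \<otimes> f" using c(1-6,8-13) by (simp add: m_ac)
    also have "\<dots> = (c \<otimes> b) \<otimes> f" using c by simp
    also have "\<dots> = (c \<otimes> f) \<otimes> b" using c(1-6,8-13) by (simp add: m_ac)
    also have "\<dots> = (e \<otimes> d) \<otimes> b" using c by simp
    also have "\<dots> = d \<otimes> (e \<otimes> b)" using c(1-6,8-13) by (simp add: m_ac)
    finally have "a \<otimes> f = e \<otimes> b" using c by (simp add: m_lcancel)
    then show "((a, b), (e, f)) \<in> frac_rel R" using c by (simp add: frac_rel_def)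
  qed
qed

lemma fraction_eq_iff:
  assumes "a \<in> carrier R" "b \<in> carrier R - {\<zero>}" "c \<in> carrier R" "d \<in> carrier R - {\<zero>}"
  shows "fraction R a b = fraction R c d \<longleftrightarrow> a \<otimes> d = c \<otimes> b"
  using assms eq_equiv_class_iff[OF equiv_frac_rel, of "(a, b)" "(c, d)"]
  by (simp add: fraction_def frac_rel_def)

lemma fraction_closed:
  assumes "a \<in> carrier R" "b \<in> carrier R - {\<zero>}"
  shows "fraction R a b \<in> carrier (frac_field R)"
  using assms by (auto simp: frac_field_def fraction_def intro: quotientI)

lemma frac_field_cases:
  assumes "x \<in> carrier (frac_field R)"
  obtains a b where "a \<in> carrier R" "b \<in> carrier R - {\<zero>}" "x = fraction R a b"
  using assms unfolding frac_field_def fraction_def by (auto elim!: quotientE)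

lemma fraction_repr:
  assumes "a \<in> carrier R" "b \<in> carrier R - {\<zero>}"
  shows "(a, b) \<in> fraction R a b"
  using assms by (simp add: fraction_def frac_rel_def)

lemma fraction_mult:
  assumes "a \<in> carrier R" "b \<in> carrier R - {\<zero>}" "c \<in> carrier R" "d \<in> carrier R - {\<zero>}"
  shows "fraction R a b \<otimes>\<^bsub>frac_field R\<^esub> fraction R c d = fraction R (a \<otimes> c) (b \<otimes> d)"
proof -
  have "fraction R (a' \<otimes> c') (b' \<otimes> d') = fraction R (a \<otimes> c) (b \<otimes> d)"
    if *: "(a', b') \<in> fraction R a b" "(c', d') \<in> fraction R c d" for a' b' c' d'
  proof -
    have r: "((a, b), (a', b')) \<in> frac_rel R" "((c, d), (c', d')) \<in> frac_rel R"
      using * by (auto simp: fraction_def)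
    note f = frac_relD[OF r(1)] frac_relD[OF r(2)]
    have "(a' \<otimes> c') \<otimes> (b \<otimes> d) = (a' \<otimes> b) \<otimes> (c' \<otimes> d)"
      using f(1-6,8-13) by (simp add: m_ac)
    also have "\<dots> = (a \<otimes> b') \<otimes> (c \<otimes> d')" using f(7,14) by simp
    also have "\<dots> = (a \<otimes> c) \<otimes> (b' \<otimes> d')" using f(1-6,8-13) by (simp add: m_ac)
    finally have "(a' \<otimes> c') \<otimes> (b \<otimes> d) = (a \<otimes> c) \<otimes> (b' \<otimes> d')" .
    moreover have "b \<otimes> d \<noteq> \<zero>" "b' \<otimes> d' \<noteq> \<zero>"
      using f by (simp_all add: integral_iff)
    ultimately show ?thesis using f by (simp add: fraction_eq_iff)
  qed
  moreover have "fraction R a b \<noteq> {}" "fraction R c d \<noteq> {}"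
    using fraction_repr[OF assms(1,2)] fraction_repr[OF assms(3,4)] by auto
  ultimately show ?thesis
    unfolding frac_field_def by (simp add: UN_pairs_const)
qed

lemma fraction_add:
  assumes "a \<in> carrier R" "b \<in> carrier R - {\<zero>}" "c \<in> carrier R" "d \<in> carrier R - {\<zero>}"
  shows "fraction R a b \<oplus>\<^bsub>frac_field R\<^esub> fraction R c d
           = fraction R ((a \<otimes> d) \<oplus> (c \<otimes> b)) (b \<otimes> d)"
proof -
  have "fraction R ((a' \<otimes> d') \<oplus> (c' \<otimes> b')) (b' \<otimes> d') = fraction R ((a \<otimes> d) \<oplus> (c \<otimes> b)) (b \<otimes> d)"
    if *: "(a', b') \<in> fraction R a b" "(c', d') \<in> fraction R c d" for a' b' c' d'
  proof -
    have r: "((a, b), (a', b')) \<in> frac_rel R" "((c, d), (c', d')) \<in> frac_rel R"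
      using * by (auto simp: fraction_def)
    note f = frac_relD[OF r(1)] frac_relD[OF r(2)]
    have "((a' \<otimes> d') \<oplus> (c' \<otimes> b')) \<otimes> (b \<otimes> d)
        = ((a' \<otimes> b) \<otimes> (d' \<otimes> d)) \<oplus> ((c' \<otimes> d) \<otimes> (b' \<otimes> b))"
      using f(1-6,8-13) by (simp add: l_distr r_distr m_ac)
    also have "\<dots> = ((a \<otimes> b') \<otimes> (d' \<otimes> d)) \<oplus> ((c \<otimes> d') \<otimes> (b' \<otimes> b))"
      using f(7,14) by simp
    also have "\<dots> = ((a \<otimes> d) \<oplus> (c \<otimes> b)) \<otimes> (b' \<otimes> d')"
      using f(1-6,8-13) by (simp add: l_distr r_distr m_ac)
    finally have "((a' \<otimes> d') \<oplus> (c' \<otimes> b')) \<otimes> (b \<otimes> d)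
        = ((a \<otimes> d) \<oplus> (c \<otimes> b)) \<otimes> (b' \<otimes> d')" .
    moreover have "b \<otimes> d \<noteq> \<zero>" "b' \<otimes> d' \<noteq> \<zero>"
      using f by (simp_all add: integral_iff)
    ultimately show ?thesis using f by (simp add: fraction_eq_iff)
  qed
  moreover have "fraction R a b \<noteq> {}" "fraction R c d \<noteq> {}"
    using fraction_repr[OF assms(1,2)] fraction_repr[OF assms(3,4)] by auto
  ultimately show ?thesis
    unfolding frac_field_def by (simp add: UN_pairs_const)
qed

end

section \<open>Affine varieties in a space of functions\<close>

interpretation func: vector_space "\<lambda>(c::complex) (f :: 'a \<Rightarrow> complex) x. c * f x"
  by unfold_locales (auto simp: fun_eq_iff algebra_simps)

text \<open>The ambient affine space is a linear subspace \<open>W\<close> of a space of complex-valued functions.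
  Values of the functions below outside \<open>W\<close> are irrelevant.\<close>

definition linear_form_on :: "('a \<Rightarrow> complex) set \<Rightarrow> (('a \<Rightarrow> complex) \<Rightarrow> complex) \<Rightarrow> bool" where
  "linear_form_on W \<phi> \<longleftrightarrow>
     (\<forall>u\<in>W. \<forall>v\<in>W. \<phi> (u + v) = \<phi> u + \<phi> v) \<and>
     (\<forall>c. \<forall>u\<in>W. \<phi> (\<lambda>x. c * u x) = c * \<phi> u)"

inductive_set polynomial_functions ::
  "('a \<Rightarrow> complex) set \<Rightarrow> (('a \<Rightarrow> complex) \<Rightarrow> complex) set" for W where
  const: "(\<lambda>_. c) \<in> polynomial_functions W"
| linear: "linear_form_on W \<phi> \<Longrightarrow> \<phi> \<in> polynomial_functions W"
| add: "\<lbrakk>F \<in> polynomial_functions W; H \<in> polynomial_functions W\<rbrakk>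
    \<Longrightarrow> (\<lambda>w. F w + H w) \<in> polynomial_functions W"
| mult: "\<lbrakk>F \<in> polynomial_functions W; H \<in> polynomial_functions W\<rbrakk>
    \<Longrightarrow> (\<lambda>w. F w * H w) \<in> polynomial_functions W"

definition zariski_closure ::
  "('a \<Rightarrow> complex) set \<Rightarrow> ('a \<Rightarrow> complex) set \<Rightarrow> ('a \<Rightarrow> complex) set" where
  "zariski_closure W A =
     {w \<in> W. \<forall>F \<in> polynomial_functions W. (\<forall>a\<in>A. F a = 0) \<longrightarrow> F w = 0}"

text \<open>The coordinate ring of the reduced closed subvariety \<open>Z \<subseteq> W\<close>.\<close>

definition coordinate_ring ::
  "('a \<Rightarrow> complex) set \<Rightarrow> ('a \<Rightarrow> complex) set \<Rightarrow> (('a \<Rightarrow> complex) \<Rightarrow> complex) ring" where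
  "coordinate_ring W Z = \<lparr>
     carrier = (\<lambda>F. restrict F Z) ` polynomial_functions W,
     mult = (\<lambda>f h. \<lambda>z\<in>Z. f z * h z),
     one = (\<lambda>z\<in>Z. 1),
     zero = (\<lambda>z\<in>Z. 0),
     add = (\<lambda>f h. \<lambda>z\<in>Z. f z + h z)\<rparr>"

text \<open>Normality of an irreducible affine variety; irreducibility is part of the definition,
  as \<open>integrally_closed_domain\<close> requires the coordinate ring to be a domain.\<close>

definition normal_affine_variety :: "('a \<Rightarrow> complex) set \<Rightarrow> ('a \<Rightarrow> complex) set \<Rightarrow> bool" where
  "normal_affine_variety W Z \<longleftrightarrow> integrally_closed_domain (coordinate_ring W Z)"

section \<open>The padded permanent\<close>

text \<open>An endomorphism of \<open>\<complex>\<^sup>m\<close>, \<open>m = CARD('m)\<close>, is the vector of its matrix entries, so that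
  the library's linear algebra for \<open>(*s)\<close> applies to \<open>End(\<complex>\<^sup>m)\<close>. The numbering
  of the basis of \<open>\<complex>\<^sup>m\<close> is a bijection \<open>e\<close> from \<open>{1..m}\<close> to \<open>'m\<close>.\<close>

type_synonym 'm endo = "complex ^ ('m \<times> 'm)"

definition entry :: "(nat \<Rightarrow> 'm::finite) \<Rightarrow> 'm endo \<Rightarrow> nat \<Rightarrow> nat \<Rightarrow> complex" where
  "entry e M i j = M $ (e i, e j)"

definition matrix_unit :: "(nat \<Rightarrow> 'm::finite) \<Rightarrow> nat \<times> nat \<Rightarrow> 'm endo" where
  "matrix_unit e = (\<lambda>(i, j). axis (e i, e j) 1)"

definition forms :: "nat \<Rightarrow> ('m::finite endo \<Rightarrow> complex) set" where
  "forms d = func.span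
     {\<lambda>M. \<Prod>k<d. \<phi> k M | \<phi>. \<forall>k<d. Vector_Spaces.linear (*s) (*) (\<phi> k)}"

definition GL :: "('m::finite endo \<Rightarrow> 'm endo) set" where
  "GL = {g. Vector_Spaces.linear (*s) (*s) g \<and> bij g}"

definition act :: "('m::finite endo \<Rightarrow> 'm endo) \<Rightarrow> ('m endo \<Rightarrow> complex) \<Rightarrow> 'm endo \<Rightarrow> complex" where
  "act g q = (\<lambda>M. q (inv_into UNIV g M))"

definition permanent :: "nat set \<Rightarrow> (nat \<Rightarrow> nat \<Rightarrow> complex) \<Rightarrow> complex" where
  "permanent I x = (\<Sum>\<sigma> | \<sigma> permutes I. \<Prod>i\<in>I. x i (\<sigma> i))"

definition padded_perm :: "(nat \<Rightarrow> 'm::finite) \<Rightarrow> nat \<Rightarrow> nat \<Rightarrow> 'm endo \<Rightarrow> complex" where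
  "padded_perm e m n M = entry e M 1 1 ^ (m - n) * permanent {m - n + 1..m} (entry e M)"

definition S_index :: "nat \<Rightarrow> nat \<Rightarrow> (nat \<times> nat) set" where
  "S_index m n = insert (1, 1) ({m - n + 1..m} \<times> {m - n + 1..m})"

definition S_space :: "(nat \<Rightarrow> 'm::finite) \<Rightarrow> nat \<Rightarrow> nat \<Rightarrow> 'm endo set" where
  "S_space e m n = vec.span (matrix_unit e ` S_index m n)"

definition S_perp :: "(nat \<Rightarrow> 'm::finite) \<Rightarrow> nat \<Rightarrow> nat \<Rightarrow> 'm endo set" where
  "S_perp e m n = vec.span (matrix_unit e ` ({1..m} \<times> {1..m} - S_index m n))"

definition L_P2 :: "(nat \<Rightarrow> 'm::finite) \<Rightarrow> nat \<Rightarrow> nat \<Rightarrow> ('m endo \<Rightarrow> 'm endo) set" where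
  "L_P2 e m n = {g \<in> GL. g ` S_space e m n = S_space e m n \<and> (\<forall>M \<in> S_perp e m n. g M = M)}"

definition orbit_closure :: "(nat \<Rightarrow> 'm::finite) \<Rightarrow> nat \<Rightarrow> nat \<Rightarrow> ('m endo \<Rightarrow> complex) set" where
  "orbit_closure e m n =
     zariski_closure (forms m) ((\<lambda>g. act g (padded_perm e m n)) ` L_P2 e m n)"

end

theory Submission
  imports
    Defs
    "Jordan_Normal_Form.Determinant"
    "HOL-Computational_Algebra.Polynomial_FPS"
    "HOL-Computational_Algebra.Fundamental_Theorem_Algebra"
begin

text \<open>A point of the orbit has the form \<open>\<ell>\<close> to the power \<open>m - n\<close> times \<open>f\<close>, with \<open>\<ell>\<close> a linear form and \<open>f\<close> of
  degree \<open>n\<close>. Restricted to a line \<open>x u + v\<close> it becomes a polynomial in \<open>x\<close> whose coefficients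
  \<open>c\<^sub>0, c\<^sub>1, \<dots>\<close> are coordinates on the variety and which has a root of multiplicity at least
  \<open>m - n\<close>, namely \<open>- \<ell>(v) / \<ell>(u)\<close>. The leading coefficient \<open>c\<^sub>0\<close> times that root is integral over the
  coordinate ring, and, being a multiple root, it is a quotient of two polynomials in the
  coefficients. On a normal variety it would therefore be a polynomial function, and, being
  homogeneous of degree one along the cone, a linear form \<open>\<phi>\<close> on the forms of degree \<open>m\<close>. But there
  is a curve \<open>p\<^sub>\<epsilon>\<close> in the orbit, polynomial in \<open>\<epsilon>\<close>, whose first order term vanishes although
  \<open>\<phi>(p\<^sub>\<epsilon>)\<close> is a nonzero multiple of \<open>\<epsilon>\<close>.\<close>

section \<open>Power sums and Hankel determinants\<close>

text \<open>Counting the multiple root with weight \<open>r = m - n\<close> makes the power sums of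
  all \<open>m\<close> roots moments of only \<open>n + 1\<close> nodes. They determine the
  unweighted sum of the nodes, and the first power sum exceeds it by \<open>r - 1\<close> times the
  root. The resulting quotient is meaningful only where the Hankel determinant is nonzero, that is,
  where the \<open>n + 1\<close> nodes are distinct. This shapes the curve: restricted to the chosen
  line, its points must have \<open>n + 1\<close> distinct roots, which asks for distinct nonzero
  weights \<open>\<eta>\<close>. With \<open>s\<close> the corner coordinate and
  \<open>\<mu>\<close> the mean of the block entries, \<open>s\<close> becomes
  \<open>s + \<epsilon> \<mu>\<close> and a block entry \<open>y\<close> in row \<open>i\<close>
  becomes \<open>s + \<epsilon> (y + \<eta> i * \<mu>)\<close>. At \<open>\<epsilon> = 0\<close> all
  factors collapse to \<open>s\<close>. The first order term is \<open>n! s^(m - 1) \<mu>\<close>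
  times \<open>(m - n) + n\<close> plus the sum of the weights; this fixes that sum to be
  \<open>- m\<close>. A coefficient in \<open>\<epsilon>\<close> is a fixed linear combination of
  finitely many points of the curve, so \<open>\<phi>\<close> can be applied to it directly.\<close>

fun newton_seq :: "nat \<Rightarrow> (nat \<Rightarrow> 'a::comm_ring_1) \<Rightarrow> nat \<Rightarrow> 'a" where
  "newton_seq m q k = (of_nat m - of_nat k) * q k - (\<Sum>i\<in>{1..k}. q i * newton_seq m q (k - i))"

declare newton_seq.simps [simp del]

lemma fps_geometric: "(1 - fps_const x * fps_X) * Abs_fps (\<lambda>k. x ^ k) = (1 :: 'a::field fps)"
proof (rule fps_ext)
  fix k
  show "fps_nth ((1 - fps_const x * fps_X) * Abs_fps (\<lambda>k. x ^ k)) k = fps_nth 1 k"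
    by (cases k) (simp_all add: left_diff_distrib mult.assoc fps_X_mult_nth)
qed

text \<open>Logarithmic derivative of the reversed polynomial: a factor \<open>1 - x X\<close>
  contributes the geometric series of \<open>x\<close>. Power series treat all \<open>k\<close>
  uniformly, also those beyond the number of roots.\<close>

lemma newton_identity_fps:
  fixes M :: "'a::field multiset"
  defines "C \<equiv> \<lambda>M. (\<Prod>x\<in>#M. 1 - fps_const x * fps_X :: 'a fps)"
  shows "of_nat (size M) * C M - fps_X * fps_deriv (C M) = C M * Abs_fps (\<lambda>k. \<Sum>x\<in>#M. x ^ k)"
proof (induction M)
  case empty
  show ?case by (simp add: C_def fps_eq_iff)
next
  case (add x M)
  define L where "L = 1 - fps_const x * fps_X"
  define P where "P = Abs_fps (\<lambda>k. \<Sum>x\<in>#M. x ^ k)"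
  define G where "G = Abs_fps (\<lambda>k. x ^ k)"
  have LG: "L * G = 1" unfolding L_def G_def by (rule fps_geometric)
  have C: "C (add_mset x M) = L * C M" by (simp add: C_def L_def)
  have P: "Abs_fps (\<lambda>k. \<Sum>x\<in>#add_mset x M. x ^ k) = G + P"
    by (simp add: fps_eq_iff G_def P_def)
  have dL: "fps_deriv L = - fps_const x" by (simp add: L_def)
  have Lx: "L + fps_const x * fps_X = 1" by (simp add: L_def)
  have "of_nat (size (add_mset x M)) * C (add_mset x M) - fps_X * fps_deriv (C (add_mset x M))
      = L * (of_nat (size M) * C M - fps_X * fps_deriv (C M)) + (L + fps_const x * fps_X) * C M"
    by (simp add: C dL algebra_simps flip: fps_const_neg)
  also have "\<dots> = L * (C M * P) + (L * G) * C M"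
    using add.IH by (simp add: P_def Lx LG)
  also have "\<dots> = C (add_mset x M) * (G + P)"
    by (simp add: C algebra_simps)
  finally show ?case by (simp only: P)
qed

text \<open>The reversed polynomial has constant term 1, so comparing coefficients in the preceding
  identity can be solved for the top power sum without division. Every power sum, including the
  zeroth one, is thereby a polynomial in the coefficients.\<close>

lemma newton_seq_power_sums:
  fixes M :: "'a::field multiset"
  defines "Q \<equiv> (\<Prod>x\<in>#M. [:- x, 1:])"
  shows "newton_seq (size M) (Polynomial.coeff (reflect_poly Q)) k = (\<Sum>x\<in>#M. x ^ k)"
proof -
  define q where "q = Polynomial.coeff (reflect_poly Q)"
  have refl: "fps_of_poly (reflect_poly Q) = (\<Prod>x\<in>#M. 1 - fps_const x * fps_X)"
    unfolding Q_def
  proof (induction M)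
    case (add x M)
    have "reflect_poly [:- x, 1:] = [:1, - x:]"
      by (simp add: reflect_poly_def)
    then show ?case
      using add
      by (simp add: reflect_poly_mult fps_of_poly_mult fps_of_poly_linear' del: mult_pCons_left
          flip: fps_const_neg)
  qed simp
  have q: "fps_nth (\<Prod>x\<in>#M. 1 - fps_const x * fps_X) = q"
    unfolding refl[symmetric] q_def by (simp add: fun_eq_iff)
  have q0: "q 0 = 1"
    unfolding q[symmetric] by (induction M) simp_all
  have id: "(of_nat (size M) - of_nat k) * q k = (\<Sum>i\<in>{0..k}. q i * (\<Sum>x\<in>#M. x ^ (k - i)))" for k
  proof -
    have "fps_nth (of_nat (size M) * (\<Prod>x\<in>#M. 1 - fps_const x * fps_X) -
        fps_X * fps_deriv (\<Prod>x\<in>#M. 1 - fps_const x * fps_X)) k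
      = (\<Sum>i\<in>{0..k}. q i * (\<Sum>x\<in>#M. x ^ (k - i)))"
      by (simp add: newton_identity_fps fps_mult_nth q)
    moreover have "fps_nth (of_nat (size M) * F - fps_X * fps_deriv F) k
      = (of_nat (size M) - of_nat k) * fps_nth F k" for F :: "'a fps"
      unfolding fps_of_nat[symmetric]
      by (cases k) (simp_all add: fps_X_mult_nth left_diff_distrib)
    ultimately show ?thesis by (simp only: q)
  qed
  show ?thesis
    unfolding q_def[symmetric]
  proof (induction k rule: less_induct)
    case (less k)
    have "newton_seq (size M) q k
        = (of_nat (size M) - of_nat k) * q k - (\<Sum>i\<in>{1..k}. q i * (\<Sum>x\<in>#M. x ^ (k - i)))"
      by (subst newton_seq.simps) (simp add: less)
    also have "\<dots> = (\<Sum>x\<in>#M. x ^ k)"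
      by (simp add: id sum.atLeast_Suc_atMost q0 multiset.map_comp comp_def)
    finally show ?case .
  qed
qed

definition hankel_det :: "nat \<Rightarrow> (nat \<Rightarrow> 'a::comm_ring_1) \<Rightarrow> 'a" where
  "hankel_det n h = Determinant.det (Matrix.mat (Suc n) (Suc n) (\<lambda>(i, j). h (i + j)))"

text \<open>Only the last column is advanced by one index: this is the numerator in Cramer's rule
  for minus the subleading coefficient of the monic polynomial whose roots are the nodes.\<close>

definition hankel_det_shift :: "nat \<Rightarrow> (nat \<Rightarrow> 'a::comm_ring_1) \<Rightarrow> 'a" where
  "hankel_det_shift n h = Determinant.det (Matrix.mat (Suc n) (Suc n)
     (\<lambda>(i, j). if j = n then h (Suc (i + j)) else h (i + j)))"

lemma monic_prod_linear:
  fixes z :: "nat \<Rightarrow> 'a::field"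
  shows "Polynomial.degree (\<Prod>l<k. [:- z l, 1:]) = k \<and> Polynomial.coeff (\<Prod>l<k. [:- z l, 1:]) k = 1"
proof (induction k)
  case (Suc k)
  define P where "P = (\<Prod>l<k. [:- z l, 1:])"
  have P: "Polynomial.degree P = k" "Polynomial.coeff P k = 1" using Suc by (simp_all add: P_def)
  then have "P \<noteq> 0" by auto
  then have "Polynomial.degree (P * [:- z k, 1:]) = Suc k"
    by (subst degree_mult_eq) (simp_all add: P)
  moreover have "Polynomial.coeff (P * [:- z k, 1:]) (Suc k) = 1"
    using P by (simp add: coeff_eq_0)
  ultimately show ?case by (simp add: P_def)
qed simp

lemma coeff_prod_linear_second:
  fixes z :: "nat \<Rightarrow> 'a::field"
  shows "Polynomial.coeff (\<Prod>l<Suc k. [:- z l, 1:]) k = - (\<Sum>l<Suc k. z l)"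
proof (induction k)
  case (Suc k)
  then show ?case
    using monic_prod_linear[of z "Suc k"]
    by (simp only: prod.lessThan_Suc[of _ "Suc k"] sum.lessThan_Suc[of _ "Suc k"])
       (simp add: algebra_simps del: prod.lessThan_Suc sum.lessThan_Suc)
qed simp

text \<open>The coefficients of \<open>R\<close>, which vanishes at all nodes, give a linear
  recurrence for the moments. So minus its lower coefficients solve the Hankel system with the
  advanced column on the right, and the last unknown is the sum of the nodes. In product form this
  holds for coinciding nodes too.\<close>

lemma hankel_det_shift_power_sums:
  fixes z w :: "nat \<Rightarrow> 'a::field"
  assumes h: "\<And>k. h k = (\<Sum>l<Suc n. w l * z l ^ k)"
  shows "hankel_det_shift n h = (\<Sum>l<Suc n. z l) * hankel_det n h"
proof -
  define R where "R = (\<Prod>l<Suc n. [:- z l, 1:])"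
  have R: "Polynomial.degree R = Suc n" "Polynomial.coeff R (Suc n) = 1"
    using monic_prod_linear[of z "Suc n"] by (simp_all only: R_def)
  have R0: "poly R (z l) = 0" if "l < Suc n" for l
    using that unfolding R_def poly_prod by (intro prod_zero) auto
  define H where "H = Matrix.mat (Suc n) (Suc n) (\<lambda>(i, j). h (i + j))"
  define x where "x = Matrix.vec (Suc n) (\<lambda>j. - Polynomial.coeff R j)"
  have H: "H \<in> carrier_mat (Suc n) (Suc n)" and x: "x \<in> carrier_vec (Suc n)"
    by (simp_all add: H_def x_def)
  have rel: "(\<Sum>j<Suc n. h (i + j) * Polynomial.coeff R j) = - h (Suc (i + n))" for i
  proof -
    have "(\<Sum>j\<le>Suc n. h (i + j) * Polynomial.coeff R j)
        = (\<Sum>j\<le>Suc n. \<Sum>l<Suc n. w l * z l ^ i * (Polynomial.coeff R j * z l ^ j))"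
      unfolding h sum_distrib_right by (intro sum.cong refl) (simp add: power_add algebra_simps)
    also have "\<dots> = (\<Sum>l<Suc n. w l * z l ^ i * poly R (z l))"
      by (subst sum.swap) (simp only: poly_altdef R(1) sum_distrib_left)
    also have "\<dots> = 0" by (intro sum.neutral) (simp add: R0)
    finally show ?thesis
      using R by (simp add: lessThan_Suc_atMost eq_neg_iff_add_eq_0)
  qed
  have Hx: "vec_index (H *\<^sub>v x) i = h (Suc (i + n))" if "i < Suc n" for i
  proof -
    have "vec_index (H *\<^sub>v x) i = - (\<Sum>j<Suc n. h (i + j) * Polynomial.coeff R j)"
      using that by (simp add: H_def x_def scalar_prod_def sum_negf atLeast0LessThan
          del: sum.lessThan_Suc sum.op_ivl_Suc)
    then show ?thesis by (simp only: rel) simp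
  qed
  have "replace_col H (H *\<^sub>v x) n = Matrix.mat (Suc n) (Suc n)
     (\<lambda>(i, j). if j = n then h (Suc (i + j)) else h (i + j))"
    using Hx by (intro eq_matI) (auto simp: replace_col_def H_def simp del: index_mult_mat_vec)
  moreover have "vec_index x n = (\<Sum>l<Suc n. z l)"
    by (simp add: x_def R_def coeff_prod_linear_second del: prod.lessThan_Suc sum.lessThan_Suc)
  ultimately show ?thesis
    using cramer_lemma_mat[OF H x, of n]
    by (simp add: hankel_det_shift_def hankel_det_def H_def)
qed

text \<open>A kernel vector, read as a polynomial \<open>V\<close> of degree at most
  \<open>n\<close>, is orthogonal to all such polynomials for the measure with masses
  \<open>w l\<close> at \<open>z l\<close>. Testing against polynomials that vanish at all nodes but
  one forces \<open>V\<close> to vanish at \<open>n + 1\<close> distinct points.\<close>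

lemma hankel_det_power_sums_nonzero:
  fixes z w :: "nat \<Rightarrow> 'a::field"
  assumes h: "\<And>k. h k = (\<Sum>l<Suc n. w l * z l ^ k)"
    and inj: "inj_on z {..<Suc n}" and w: "\<And>l. l < Suc n \<Longrightarrow> w l \<noteq> 0"
  shows "hankel_det n h \<noteq> 0"
proof
  define H where "H = Matrix.mat (Suc n) (Suc n) (\<lambda>(i, j). h (i + j))"
  assume "hankel_det n h = 0"
  then obtain v where v: "v \<in> carrier_vec (Suc n)" "v \<noteq> 0\<^sub>v (Suc n)" "H *\<^sub>v v = 0\<^sub>v (Suc n)"
    using det_0_iff_vec_prod_zero_field[of H "Suc n"] by (auto simp: hankel_det_def H_def)
  define V where "V = (\<Sum>j<Suc n. Polynomial.monom (vec_index v j) j)"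
  have pV: "poly V y = (\<Sum>j<Suc n. vec_index v j * y ^ j)" for y
    by (simp only: V_def poly_sum poly_monom)
  have degV: "Polynomial.degree V \<le> n"
    unfolding V_def by (intro degree_sum_le) (auto intro: order.trans[OF degree_monom_le])
  have moment: "(\<Sum>l<Suc n. w l * poly V (z l) * z l ^ i) = 0" if "i < Suc n" for i
  proof -
    have "0 = vec_index (H *\<^sub>v v) i" using v(3) that by simp
    also have "\<dots> = (\<Sum>j<Suc n. h (i + j) * vec_index v j)"
      using that v(1) by (simp add: H_def scalar_prod_def atLeast0LessThan
        del: sum.lessThan_Suc sum.op_ivl_Suc)
    also have "\<dots> = (\<Sum>j<Suc n. \<Sum>l<Suc n. w l * z l ^ i * (vec_index v j * z l ^ j))"
      unfolding h sum_distrib_right by (intro sum.cong refl) (simp add: power_add algebra_simps)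
    also have "\<dots> = (\<Sum>l<Suc n. w l * poly V (z l) * z l ^ i)"
      by (subst sum.swap) (simp only: pV sum_distrib_left sum_distrib_right mult_ac)
    finally show ?thesis by simp
  qed
  have root: "poly V (z l) = 0" if l: "l < Suc n" for l
  proof -
    define L where "L = (\<Prod>i\<in>{..<Suc n} - {l}. [:- z i, 1:])"
    have "Polynomial.degree L \<le> (\<Sum>i\<in>{..<Suc n} - {l}. Polynomial.degree [:- z i, 1:])"
      unfolding L_def by (rule degree_prod_sum_le[unfolded o_def]) simp
    then have degL: "Polynomial.degree L \<le> n" using l by simp
    have "(\<Sum>k<Suc n. w k * poly V (z k) * poly L (z k))
        = (\<Sum>k<Suc n. \<Sum>i\<le>Polynomial.degree L. Polynomial.coeff L i * (w k * poly V (z k) * z k ^ i))"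
      by (simp only: poly_altdef[of L] sum_distrib_left mult_ac)
    also have "\<dots> = (\<Sum>i\<le>Polynomial.degree L. Polynomial.coeff L i * (\<Sum>k<Suc n. w k * poly V (z k) * z k ^ i))"
      by (subst sum.swap) (simp only: sum_distrib_left)
    also have "\<dots> = 0"
      using degL by (intro sum.neutral ballI) (simp add: moment del: sum.lessThan_Suc)
    finally have "(\<Sum>k<Suc n. w k * poly V (z k) * poly L (z k)) = 0" .
    moreover have "poly L (z k) = 0" if "k < Suc n" "k \<noteq> l" for k
      using that unfolding L_def poly_prod by (intro prod_zero) auto
    then have "(\<Sum>k<Suc n. w k * poly V (z k) * poly L (z k))
        = (\<Sum>k<Suc n. if k = l then w l * poly V (z l) * poly L (z l) else 0)"
      by (intro sum.cong) auto
    ultimately have "w l * poly V (z l) * poly L (z l) = 0"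
      using l by (simp add: sum.delta del: sum.lessThan_Suc)
    moreover have "poly L (z l) \<noteq> 0"
      using l inj by (auto simp: L_def poly_prod inj_on_def)
    ultimately show ?thesis using w[OF l] by simp
  qed
  have "V = 0"
  proof (rule ccontr)
    assume "V \<noteq> 0"
    then have "card {x. poly V x = 0} \<le> n" using card_poly_roots_bound[of V] degV by linarith
    moreover have "z ` {..<Suc n} \<subseteq> {x. poly V x = 0}" using root by auto
    then have "card (z ` {..<Suc n}) \<le> card {x. poly V x = 0}"
      using \<open>V \<noteq> 0\<close> by (intro card_mono poly_roots_finite)
    ultimately show False using card_image[OF inj] by simp
  qed
  moreover have "Polynomial.coeff V j = vec_index v j" if "j < Suc n" for j
    using that by (simp add: V_def coeff_sum del: sum.lessThan_Suc)
  ultimately have "v = 0\<^sub>v (Suc n)"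
    using v(1) by (intro eq_vecI) auto
  with v(2) show False by simp
qed

section \<open>Multiple roots of polynomials\<close>

text \<open>The nodes are \<open>\<rho>\<close>, with weight \<open>r\<close>, followed by the roots
  of \<open>G\<close> listed with multiplicity, each with weight 1. They may coincide; the
  description of the root set allows distinctness to be read off a count.\<close>

lemma multiple_root_power_sums:
  fixes \<rho> :: "'a::alg_closed_field" and r :: nat
  assumes G: "Polynomial.degree G = n" "Polynomial.lead_coeff G = 1"
  defines "Q \<equiv> [:- \<rho>, 1:] ^ r * G"
  obtains z w where "z 0 = \<rho>" "w 0 = of_nat r" "\<And>l. l > 0 \<Longrightarrow> w l = 1"
    "\<And>k. newton_seq (r + n) (Polynomial.coeff (reflect_poly Q)) k = (\<Sum>l<Suc n. w l * z l ^ k)"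
    "r > 0 \<Longrightarrow> {x. poly Q x = 0} = z ` {..<Suc n}"
proof -
  have "G \<noteq> 0" using G(2) by auto
  from alg_closed_imp_factorization[OF this] obtain A
    where A: "size A = n" "G = (\<Prod>x\<in>#A. [:- x, 1:])"
    using G by auto
  obtain zs where zs: "mset zs = A" using ex_mset by blast
  have len: "length zs = n" using zs A(1) by auto
  define z where "z = (\<lambda>l. if l = 0 then \<rho> else zs ! (l - 1))"
  define w :: "nat \<Rightarrow> 'a" where "w = (\<lambda>l. if l = 0 then of_nat r else 1)"
  have Q: "Q = (\<Prod>x\<in>#replicate_mset r \<rho> + A. [:- x, 1:])"
    by (simp add: Q_def A(2))
  have size: "size (replicate_mset r \<rho> + A) = r + n" by (simp add: A(1))
  have "newton_seq (r + n) (Polynomial.coeff (reflect_poly Q)) k = (\<Sum>l<Suc n. w l * z l ^ k)" for k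
  proof -
    have "newton_seq (r + n) (Polynomial.coeff (reflect_poly Q)) k = of_nat r * \<rho> ^ k + (\<Sum>x\<in>#A. x ^ k)"
      using newton_seq_power_sums[of "replicate_mset r \<rho> + A" k] unfolding size Q[symmetric] by simp
    also have "(\<Sum>x\<in>#A. x ^ k) = (\<Sum>l<n. (zs ! l) ^ k)"
      by (simp add: zs[symmetric] sum_mset_sum_list sum_list_sum_nth len atLeast0LessThan flip: mset_map)
    also have "of_nat r * \<rho> ^ k + \<dots> = (\<Sum>l<Suc n. w l * z l ^ k)"
      by (simp add: sum.lessThan_Suc_shift w_def z_def del: sum.lessThan_Suc)
    finally show ?thesis .
  qed
  moreover have "{x. poly Q x = 0} = z ` {..<Suc n}" if "r > 0"
  proof -
    have "{x. poly G x = 0} = set zs"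
      unfolding A(2) zs[symmetric] by (induction zs) (auto simp del: mult_pCons_left)
    then have "{x. poly Q x = 0} = insert \<rho> (set zs)"
      using that by (auto simp: Q_def)
    also have "\<dots> = z ` {..<Suc n}"
      unfolding lessThan_Suc_eq_insert_0 image_insert image_image
      by (auto simp: z_def set_conv_nth len)
    finally show ?thesis .
  qed
  ultimately show ?thesis
    using that[of z w] by (simp add: z_def w_def del: sum.lessThan_Suc)
qed

text \<open>The power sums of the roots are moments of a measure with \<open>n + 1\<close> atoms, so Cramer's rule
  applied to their Hankel matrix yields the sum of the distinct roots; the first power sum counts
  \<open>\<rho>\<close> another \<open>r - 1\<close> times.\<close>

lemma multiple_root_rational:
  fixes \<rho> :: "'a::alg_closed_field" and r :: nat
  assumes G: "Polynomial.degree G = n" "Polynomial.lead_coeff G = 1"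
  defines "h \<equiv> newton_seq (r + n) (Polynomial.coeff (reflect_poly ([:- \<rho>, 1:] ^ r * G)))"
  shows "(of_nat r - 1) * \<rho> * hankel_det n h = h 1 * hankel_det n h - hankel_det_shift n h"
proof -
  obtain z w where zw: "z 0 = \<rho>" "w 0 = of_nat r" "\<And>l. l > 0 \<Longrightarrow> w l = 1"
    "\<And>k. h k = (\<Sum>l<Suc n. w l * z l ^ k)"
    by (rule multiple_root_power_sums[OF G, of \<rho> r]) (rule that, simp_all only: h_def)
  have "h 1 = (\<Sum>l<Suc n. z l) + (of_nat r - 1) * \<rho>"
    using zw(1-3) by (simp add: zw(4) sum.lessThan_Suc_shift algebra_simps del: sum.lessThan_Suc)
  then show ?thesis
    by (simp only: hankel_det_shift_power_sums[of h, OF zw(4)]) (simp add: algebra_simps)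
qed

text \<open>With \<open>n + 1\<close> distinct roots no two of the \<open>n + 1\<close> nodes can
  coincide, and the weights \<open>r\<close> and 1 are nonzero in characteristic 0.\<close>

lemma multiple_root_hankel_det_nonzero:
  fixes \<rho> :: "'a::{alg_closed_field,field_char_0}"
  assumes G: "Polynomial.degree G = n" "Polynomial.lead_coeff G = 1" and "r > 0"
    and roots: "card {x. poly ([:- \<rho>, 1:] ^ r * G) x = 0} = Suc n"
  shows "hankel_det n (newton_seq (r + n) (Polynomial.coeff (reflect_poly ([:- \<rho>, 1:] ^ r * G)))) \<noteq> 0"
proof -
  let ?h = "newton_seq (r + n) (Polynomial.coeff (reflect_poly ([:- \<rho>, 1:] ^ r * G)))"
  obtain z w where zw: "z 0 = \<rho>" "w 0 = of_nat r" "\<And>l. l > 0 \<Longrightarrow> w l = 1"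
    "\<And>k. ?h k = (\<Sum>l<Suc n. w l * z l ^ k)"
    "r > 0 \<Longrightarrow> {x. poly ([:- \<rho>, 1:] ^ r * G) x = 0} = z ` {..<Suc n}"
    by (rule multiple_root_power_sums[OF G, of \<rho> r]) (rule that)
  have "inj_on z {..<Suc n}"
    using roots \<open>r > 0\<close> unfolding zw(5)[OF \<open>r > 0\<close>] by (intro eq_card_imp_inj_on) simp_all
  moreover have "w l \<noteq> 0" for l
    using zw(2) zw(3)[of l] \<open>r > 0\<close> by (cases "l = 0") simp_all
  ultimately show ?thesis by (intro hankel_det_power_sums_nonzero[OF zw(4)])
qed

text \<open>For \<open>P\<close> with coefficients \<open>c\<close>, leading one first, these are
  the coefficients of \<open>c 0 ^ (m - 1) * P (y / c 0)\<close>, a monic polynomial whose roots are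
  those of \<open>P\<close> times \<open>c 0\<close>. They stay polynomial in \<open>c\<close>, and
  with the entry 1 set by hand they also make sense for \<open>c 0 = 0\<close>.\<close>

definition normalized_coeffs :: "nat \<Rightarrow> (nat \<Rightarrow> 'a::comm_ring_1) \<Rightarrow> nat \<Rightarrow> 'a" where
  "normalized_coeffs m c k = (if k = 0 then 1 else if k \<le> m then c k * c 0 ^ (k - 1) else 0)"

text \<open>Since \<open>c 0\<close> is the coefficient of \<open>P\<close> in degree
  \<open>r + n\<close>, its being nonzero excludes both \<open>a = 0\<close> and a cofactor of lower
  degree, so no degree drops under the substitution.\<close>

lemma rescaled_multiple_root:
  fixes P F :: "'a::field poly" and a b :: 'a
  assumes P: "P = [:b, a:] ^ r * F" and F: "Polynomial.degree F \<le> n" and r: "r > 0"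
  defines "m \<equiv> r + n"
  defines "c \<equiv> \<lambda>k. Polynomial.coeff P (m - k)"
  assumes c0: "c 0 \<noteq> 0"
  obtains G Q where "Polynomial.degree G = n" "Polynomial.lead_coeff G = 1"
    "Q = [:- (- (c 0 * b / a)), 1:] ^ r * G" "Polynomial.degree Q = m"
    "Polynomial.coeff (reflect_poly Q) = normalized_coeffs m c"
    "\<And>y. poly Q y = c 0 ^ (m - 1) * poly P (y / c 0)"
proof -
  have a: "a \<noteq> 0"
  proof
    assume "a = 0"
    then have "P = Polynomial.smult (b ^ r) F" by (simp add: P poly_const_pow)
    then have "Polynomial.degree P \<le> n" using F by (metis degree_smult_le order.trans)
    then show False using c0 r by (simp add: c_def m_def coeff_eq_0)
  qed
  have "F \<noteq> 0" using c0 by (auto simp: c_def P)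
  have degP: "Polynomial.degree P = r + Polynomial.degree F"
    using \<open>F \<noteq> 0\<close> a by (simp add: P degree_mult_eq degree_power_eq)
  moreover have "m \<le> Polynomial.degree P" using c0 by (auto simp: c_def intro: le_degree)
  ultimately have degF: "Polynomial.degree F = n" and degP: "Polynomial.degree P = m"
    using F by (simp_all add: m_def)
  define S where "S = [:0, 1 / c 0:]"
  define Q where "Q = Polynomial.smult (c 0 ^ (m - 1)) (pcompose P S)"
  define G where "G = Polynomial.smult (c 0 ^ (m - 1) * (a / c 0) ^ r) (pcompose F S)"
  have "pcompose [:b, a:] S = Polynomial.smult (a / c 0) [:- (- (c 0 * b / a)), 1:]"
    using a c0 by (simp add: S_def pcompose_pCons)
  moreover have "pcompose (p ^ k) S = pcompose p S ^ k" for p k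
    by (induction k) (simp_all add: pcompose_mult pcompose_1)
  ultimately have "pcompose P S = Polynomial.smult ((a / c 0) ^ r) ([:- (- (c 0 * b / a)), 1:] ^ r) * pcompose F S"
    by (simp only: P pcompose_mult smult_power)
  then have QG: "Q = [:- (- (c 0 * b / a)), 1:] ^ r * G"
    by (simp only: Q_def G_def mult_smult_left mult_smult_right smult_smult)
  have degQ: "Polynomial.degree Q = m" and degG: "Polynomial.degree G = n"
    using a c0 by (simp_all add: Q_def G_def S_def degP degF degree_pcompose)
  have coeffQ: "Polynomial.coeff Q i = c 0 ^ (m - 1) * ((1 / c 0) ^ i * Polynomial.coeff P i)" for i
    by (simp add: Q_def S_def coeff_pcompose_linear)
  have m: "m > 0" using r by (simp add: m_def)
  have refl: "Polynomial.coeff (reflect_poly Q) = normalized_coeffs m c"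
  proof
    fix k
    show "Polynomial.coeff (reflect_poly Q) k = normalized_coeffs m c k"
    proof (cases "k \<le> m")
      case True
      \<comment> \<open>As an integer the exponent of \<open>c 0\<close> is \<open>k - 1\<close>; it
        is negative for \<open>k = 0\<close>, where truncated subtraction would give 0.\<close>
      have "c 0 ^ (m - 1) * (1 / c 0) ^ (m - k) = (if k = 0 then 1 / c 0 else c 0 ^ (k - 1))"
      proof (cases k)
        case 0
        then show ?thesis using m c0 by (cases m) (simp_all add: power_one_over)
      next
        case (Suc j)
        with True have "m - 1 = j + (m - k)" by simp
        then have "c 0 ^ (m - 1) = c 0 ^ j * c 0 ^ (m - k)" by (simp only: power_add)
        then show ?thesis using c0 by (simp add: power_one_over Suc)
      qed
      then have "Polynomial.coeff Q (m - k) = (if k = 0 then 1 / c 0 else c 0 ^ (k - 1)) * c k"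
        by (simp only: coeffQ c_def mult.assoc[symmetric])
      then show ?thesis
        using True c0 by (simp add: coeff_reflect_poly degQ normalized_coeffs_def)
    qed (simp add: coeff_reflect_poly degQ normalized_coeffs_def)
  qed
  have "Polynomial.lead_coeff Q = 1"
    using fun_cong[OF refl, of 0] by (simp add: coeff_reflect_poly normalized_coeffs_def)
  then have "Polynomial.lead_coeff G = 1"
    by (simp add: QG lead_coeff_mult lead_coeff_power del: minus_minus)
  moreover have "poly Q y = c 0 ^ (m - 1) * poly P (y / c 0)" for y
    by (simp add: Q_def S_def poly_pcompose)
  ultimately show ?thesis using that degG QG degQ refl by blast
qed

text \<open>All three facts are transported from the rescaled monic polynomial: its roots are those
  of \<open>P\<close> times \<open>c 0\<close>, which explains the form of \<open>\<rho>\<close> and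
  keeps the number of distinct roots.\<close>

lemma
  fixes P F :: "'a::{alg_closed_field,field_char_0} poly" and a b :: 'a
  assumes P: "P = [:b, a:] ^ r * F" and F: "Polynomial.degree F \<le> n" and r: "r > 0"
  defines "m \<equiv> r + n"
  defines "c \<equiv> \<lambda>k. Polynomial.coeff P (m - k)"
  defines "h \<equiv> newton_seq m (normalized_coeffs m c)"
  defines "\<rho> \<equiv> - (c 0 * b / a)"
  assumes c0: "c 0 \<noteq> 0"
  shows normalized_root_rational:
      "(of_nat r - 1) * \<rho> * hankel_det n h = h 1 * hankel_det n h - hankel_det_shift n h"
    and normalized_root_integral: "(\<Sum>k\<le>m. normalized_coeffs m c k * \<rho> ^ (m - k)) = 0"
    and normalized_hankel_det_nonzero: "card {x. poly P x = 0} = Suc n \<Longrightarrow> hankel_det n h \<noteq> 0"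
proof -
  obtain G Q where G: "Polynomial.degree G = n" "Polynomial.lead_coeff G = 1"
    and Q: "Q = [:- \<rho>, 1:] ^ r * G" "Polynomial.degree Q = m"
    and refl: "Polynomial.coeff (reflect_poly Q) = normalized_coeffs m c"
    and pQ: "\<And>y. poly Q y = c 0 ^ (m - 1) * poly P (y / c 0)"
    using rescaled_multiple_root[OF P F r] c0 unfolding c_def m_def \<rho>_def by blast
  have h: "h = newton_seq (r + n) (Polynomial.coeff (reflect_poly ([:- \<rho>, 1:] ^ r * G)))"
    by (simp only: h_def m_def[symmetric] Q(1)[symmetric] refl)
  show "(of_nat r - 1) * \<rho> * hankel_det n h = h 1 * hankel_det n h - hankel_det_shift n h"
    unfolding h by (rule multiple_root_rational[OF G])
  have "(\<Sum>k\<le>m. normalized_coeffs m c k * \<rho> ^ (m - k)) = (\<Sum>k\<le>m. Polynomial.coeff Q (m - k) * \<rho> ^ (m - k))"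
    by (intro sum.cong) (simp_all add: refl[symmetric] coeff_reflect_poly Q(2))
  also have "\<dots> = (\<Sum>i\<le>m. Polynomial.coeff Q i * \<rho> ^ i)"
    using sum.nat_diff_reindex[of "\<lambda>i. Polynomial.coeff Q i * \<rho> ^ i" "Suc m"]
    by (simp add: lessThan_Suc_atMost del: sum.lessThan_Suc)
  also have "\<dots> = poly Q \<rho>" by (simp add: poly_altdef Q(2))
  also have "\<dots> = 0" using r by (simp add: Q(1))
  finally show "(\<Sum>k\<le>m. normalized_coeffs m c k * \<rho> ^ (m - k)) = 0" .
  assume card: "card {x. poly P x = 0} = Suc n"
  have "{y. poly Q y = 0} = (\<lambda>x. c 0 * x) ` {x. poly P x = 0}"
    using c0 by (auto simp: pQ image_iff intro!: exI[of _ "_ / c 0"])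
  then have "card {y. poly Q y = 0} = Suc n"
    using c0 card by (simp add: card_image inj_on_def)
  then show "hankel_det n h \<noteq> 0"
    unfolding h using r by (intro multiple_root_hankel_det_nonzero[OF G]) (simp_all only: Q(1))
qed

section \<open>Fractions and integral equations\<close>

context domain
begin

lemma cring_frac_field: "cring (frac_field R)"
proof (rule cringI)
  let ?K = "frac_field R"
  have one: "\<one>\<^bsub>?K\<^esub> = fraction R \<one> \<one>" and zero: "\<zero>\<^bsub>?K\<^esub> = fraction R \<zero> \<one>"
    by (simp_all add: frac_field_def)
  note fraction_simps = fraction_mult fraction_add fraction_closed integral_iff
  have fraction_exists: "\<exists>a b. u = fraction R a b \<and> a \<in> carrier R \<and> b \<in> carrier R \<and> b \<noteq> \<zero>"
    if "u \<in> carrier ?K" for u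
    using that by (auto elim: frac_field_cases)
  show "abelian_group ?K"
  proof (rule abelian_groupI)
    fix x y z assume K: "x \<in> carrier ?K" "y \<in> carrier ?K" "z \<in> carrier ?K"
    obtain a b c d e f where xyz: "x = fraction R a b" "y = fraction R c d" "z = fraction R e f"
      and car: "a \<in> carrier R" "b \<in> carrier R" "c \<in> carrier R" "d \<in> carrier R" "e \<in> carrier R" "f \<in> carrier R"
      and nz: "b \<noteq> \<zero>" "d \<noteq> \<zero>" "f \<noteq> \<zero>"
      using K[THEN fraction_exists] by blast
    show "x \<oplus>\<^bsub>?K\<^esub> y \<in> carrier ?K"
      using car nz by (simp add: xyz fraction_simps)
    show "x \<oplus>\<^bsub>?K\<^esub> y = y \<oplus>\<^bsub>?K\<^esub> x"
      using car nz by (simp add: xyz fraction_simps m_comm a_comm)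
    have "(a \<otimes> d \<oplus> c \<otimes> b) \<otimes> f \<oplus> e \<otimes> (b \<otimes> d) = a \<otimes> (d \<otimes> f) \<oplus> (c \<otimes> f \<oplus> e \<otimes> d) \<otimes> b"
      "b \<otimes> d \<otimes> f = b \<otimes> (d \<otimes> f)"
      using car by algebra+
    then show "(x \<oplus>\<^bsub>?K\<^esub> y) \<oplus>\<^bsub>?K\<^esub> z = x \<oplus>\<^bsub>?K\<^esub> (y \<oplus>\<^bsub>?K\<^esub> z)"
      using car nz by (simp add: xyz fraction_simps)
    show "\<zero>\<^bsub>?K\<^esub> \<oplus>\<^bsub>?K\<^esub> x = x"
      using car nz by (simp add: xyz zero fraction_simps)
    have "\<ominus> a \<otimes> b \<oplus> a \<otimes> b = \<zero>" using car by algebra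
    then show "\<exists>y\<in>carrier ?K. y \<oplus>\<^bsub>?K\<^esub> x = \<zero>\<^bsub>?K\<^esub>"
      using car nz
      by (intro bexI[of _ "fraction R (\<ominus> a) b"])
         (simp_all add: xyz zero fraction_simps fraction_eq_iff)
  qed (simp add: zero fraction_closed)
  show "Group.comm_monoid ?K"
  proof (rule comm_monoidI)
    fix x y z assume K: "x \<in> carrier ?K" "y \<in> carrier ?K" "z \<in> carrier ?K"
    obtain a b c d e f where xyz: "x = fraction R a b" "y = fraction R c d" "z = fraction R e f"
      and car: "a \<in> carrier R" "b \<in> carrier R" "c \<in> carrier R" "d \<in> carrier R" "e \<in> carrier R" "f \<in> carrier R"
      and nz: "b \<noteq> \<zero>" "d \<noteq> \<zero>" "f \<noteq> \<zero>"
      using K[THEN fraction_exists] by blast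
    show "x \<otimes>\<^bsub>?K\<^esub> y \<in> carrier ?K"
      using car nz by (simp add: xyz fraction_simps)
    show "x \<otimes>\<^bsub>?K\<^esub> y = y \<otimes>\<^bsub>?K\<^esub> x"
      using car nz by (simp add: xyz fraction_simps m_comm)
    show "(x \<otimes>\<^bsub>?K\<^esub> y) \<otimes>\<^bsub>?K\<^esub> z = x \<otimes>\<^bsub>?K\<^esub> (y \<otimes>\<^bsub>?K\<^esub> z)"
      using car nz by (simp add: xyz fraction_simps m_assoc)
    show "\<one>\<^bsub>?K\<^esub> \<otimes>\<^bsub>?K\<^esub> x = x"
      using car nz by (simp add: xyz one fraction_simps)
  qed (simp add: one fraction_closed)
  fix x y z assume K: "x \<in> carrier ?K" "y \<in> carrier ?K" "z \<in> carrier ?K"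
  obtain a b c d e f where xyz: "x = fraction R a b" "y = fraction R c d" "z = fraction R e f"
    and car: "a \<in> carrier R" "b \<in> carrier R" "c \<in> carrier R" "d \<in> carrier R" "e \<in> carrier R" "f \<in> carrier R"
    and nz: "b \<noteq> \<zero>" "d \<noteq> \<zero>" "f \<noteq> \<zero>"
    using K[THEN fraction_exists] by blast
  \<comment> \<open>The two sides of distributivity have different denominators, so they are
    compared after cross multiplication.\<close>
  have "(a \<otimes> d \<oplus> c \<otimes> b) \<otimes> e \<otimes> (b \<otimes> f \<otimes> (d \<otimes> f))
      = (a \<otimes> e \<otimes> (d \<otimes> f) \<oplus> c \<otimes> e \<otimes> (b \<otimes> f)) \<otimes> (b \<otimes> d \<otimes> f)"
    using car by algebra
  then show "(x \<oplus>\<^bsub>?K\<^esub> y) \<otimes>\<^bsub>?K\<^esub> z = x \<otimes>\<^bsub>?K\<^esub> z \<oplus>\<^bsub>?K\<^esub> y \<otimes>\<^bsub>?K\<^esub> z"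
    using car nz by (simp add: xyz fraction_simps fraction_eq_iff)
qed

lemma fraction_nat_pow:
  assumes "a \<in> carrier R" "d \<in> carrier R - {\<zero>}"
  shows "fraction R a d [^]\<^bsub>frac_field R\<^esub> (k :: nat) = fraction R (a [^] k) (d [^] k)"
proof -
  interpret K: cring "frac_field R" by (rule cring_frac_field)
  have "d [^] k \<noteq> \<zero>" for k :: nat
    using assms by (induction k) (auto simp: integral_iff)
  then show ?thesis
    using assms by (induction k) (simp_all add: fraction_mult, simp add: frac_field_def)
qed

end

text \<open>Numerator of the value at \<open>a / d\<close> over the denominator \<open>d\<close> to
  the power \<open>length qs\<close>. Taking one power more than the degree keeps the recursion
  uniform, with \<open>0 / 1\<close> for the empty list.\<close>

primrec eval_numerator :: "('a, 'b) ring_scheme \<Rightarrow> 'a \<Rightarrow> 'a \<Rightarrow> 'a list \<Rightarrow> 'a" where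
  "eval_numerator R a d [] = \<zero>\<^bsub>R\<^esub>"
| "eval_numerator R a d (q # qs)
     = d \<otimes>\<^bsub>R\<^esub> (q \<otimes>\<^bsub>R\<^esub> a [^]\<^bsub>R\<^esub> length qs \<oplus>\<^bsub>R\<^esub> eval_numerator R a d qs)"

context domain
begin

lemma eval_numerator_closed:
  assumes "a \<in> carrier R" "d \<in> carrier R" "set qs \<subseteq> carrier R"
  shows "eval_numerator R a d qs \<in> carrier R"
  using assms by (induction qs) auto

lemma eval_fraction:
  assumes "a \<in> carrier R" "d \<in> carrier R - {\<zero>}" "set qs \<subseteq> carrier R"
  shows "ring.eval (frac_field R) (map (to_frac R) qs) (fraction R a d)
    = fraction R (eval_numerator R a d qs) (d [^] length qs)"
  using assms(3)
proof (induction qs)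
  case Nil
  interpret K: cring "frac_field R" by (rule cring_frac_field)
  show ?case by simp (simp add: frac_field_def)
next
  case (Cons q qs)
  interpret K: cring "frac_field R" by (rule cring_frac_field)
  have d: "d \<in> carrier R" "d \<noteq> \<zero>" "d [^] k \<noteq> \<zero>" for k :: nat
    using assms(2) by (auto, induction k) (auto simp: integral_iff)
  have N: "eval_numerator R a d qs \<in> carrier R"
    using assms Cons.prems by (intro eval_numerator_closed) auto
  show ?case
    using assms(1) Cons d N
    by (simp add: fraction_nat_pow to_frac_def fraction_mult fraction_add fraction_eq_iff
        integral_iff m_ac l_distr r_distr)
qed

text \<open>Clears denominators: integrality of \<open>a / d\<close> becomes one equation inside the
  ring, which in a coordinate ring can be tested pointwise.\<close>

lemma integral_over_fraction:
  assumes "a \<in> carrier R" "d \<in> carrier R - {\<zero>}" "set qs \<subseteq> carrier R"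
    and "qs \<noteq> []" "hd qs = \<one>" "eval_numerator R a d qs = \<zero>"
  shows "integral_over (frac_field R) (to_frac R ` carrier R) (fraction R a d)"
proof -
  interpret K: cring "frac_field R" by (rule cring_frac_field)
  have one: "to_frac R \<one> = \<one>\<^bsub>frac_field R\<^esub>" by (simp add: to_frac_def frac_field_def)
  have zero: "\<zero>\<^bsub>frac_field R\<^esub> = fraction R \<zero> \<one>" by (simp add: frac_field_def)
  have "\<one>\<^bsub>frac_field R\<^esub> \<noteq> \<zero>\<^bsub>frac_field R\<^esub>"
    by (simp add: one[symmetric] to_frac_def zero fraction_eq_iff)
  then have pol: "polynomial\<^bsub>frac_field R\<^esub> (to_frac R ` carrier R) (map (to_frac R) qs)"
    using assms(3-5) by (auto simp: polynomial_def hd_map one)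
  have "d [^] length qs \<noteq> \<zero>"
    using assms(2) by (induction qs) (auto simp: integral_iff)
  then have "ring.eval (frac_field R) (map (to_frac R) qs) (fraction R a d) = \<zero>\<^bsub>frac_field R\<^esub>"
    using assms by (simp add: eval_fraction zero fraction_eq_iff)
  then show ?thesis
    using assms pol unfolding integral_over_def
    by (intro conjI exI[of _ "map (to_frac R) qs"]) (simp_all add: fraction_closed hd_map one)
qed

end

section \<open>Polynomial functions and coordinate rings\<close>

lemma polynomial_functions_sum:
  assumes "\<And>i. i \<in> I \<Longrightarrow> F i \<in> polynomial_functions W"
  shows "(\<lambda>w. \<Sum>i\<in>I. F i w) \<in> polynomial_functions W"
  using assms
  by (induction I rule: infinite_finite_induct)
     (auto intro: polynomial_functions.const polynomial_functions.add)

lemma polynomial_functions_prod: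
  assumes "\<And>i. i \<in> I \<Longrightarrow> F i \<in> polynomial_functions W"
  shows "(\<lambda>w. \<Prod>i\<in>I. F i w) \<in> polynomial_functions W"
  using assms
  by (induction I rule: infinite_finite_induct)
     (auto intro: polynomial_functions.const polynomial_functions.mult)

lemma polynomial_functions_power:
  assumes "F \<in> polynomial_functions W"
  shows "(\<lambda>w. F w ^ k) \<in> polynomial_functions W"
  using polynomial_functions_prod[of "{..<k}" "\<lambda>_. F" W] assms by simp

lemma polynomial_functions_diff:
  assumes "F \<in> polynomial_functions W" "H \<in> polynomial_functions W"
  shows "(\<lambda>w. F w - H w) \<in> polynomial_functions W"
  using polynomial_functions.add[OF assms(1)
      polynomial_functions.mult[OF polynomial_functions.const[of "-1"] assms(2)]] by simp

lemmas polynomial_functions_intros = polynomial_functions.const polynomial_functions.add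
  polynomial_functions.mult polynomial_functions_sum polynomial_functions_prod
  polynomial_functions_power polynomial_functions_diff

lemma polynomial_functions_hankel_det:
  assumes "\<And>k. h k \<in> polynomial_functions W"
  shows "(\<lambda>w. hankel_det n (\<lambda>k. h k w)) \<in> polynomial_functions W"
  unfolding hankel_det_def Determinant.det_def
  by (auto intro!: polynomial_functions_intros assms)

lemma polynomial_functions_hankel_det_shift:
  assumes "\<And>k. h k \<in> polynomial_functions W"
  shows "(\<lambda>w. hankel_det_shift n (\<lambda>k. h k w)) \<in> polynomial_functions W"
proof -
  have "(\<lambda>w. if b then h i w else h j w) \<in> polynomial_functions W" for b i j
    using assms by (cases b) simp_all
  then show ?thesis
    unfolding hankel_det_shift_def Determinant.det_def
    by (auto intro!: polynomial_functions_intros assms)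
qed

lemma polynomial_functions_newton_seq:
  assumes "\<And>k. q k \<in> polynomial_functions W"
  shows "(\<lambda>w. newton_seq m (\<lambda>k. q k w) k) \<in> polynomial_functions W"
proof (induction k rule: less_induct)
  case (less k)
  show ?case
    by (subst newton_seq.simps) (auto intro!: polynomial_functions_intros assms less)
qed

text \<open>Membership in \<open>W\<close> is carried along in the induction because
  \<open>\<phi>\<close> is additive only on \<open>W\<close>.\<close>

lemma linear_form_on_sum:
  assumes "linear_form_on W \<phi>" "func.subspace W" "\<And>j. j \<in> J \<Longrightarrow> w j \<in> W"
  shows "\<phi> (\<lambda>x. \<Sum>j\<in>J. a j * w j x) = (\<Sum>j\<in>J. a j * \<phi> (w j)) \<and> (\<lambda>x. \<Sum>j\<in>J. a j * w j x) \<in> W"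
proof -
  have zero: "(\<lambda>x. 0) \<in> W" "\<phi> (\<lambda>x. 0) = 0"
  proof -
    show W: "(\<lambda>x. 0) \<in> W" using func.subspace_0[OF assms(2)] by (simp add: zero_fun_def)
    have "\<forall>c. \<forall>u\<in>W. \<phi> (\<lambda>x. c * u x) = c * \<phi> u"
      using assms(1) by (simp add: linear_form_on_def)
    from bspec[OF spec[OF this, of 0] W] show "\<phi> (\<lambda>x. 0) = 0" by simp
  qed
  show ?thesis
    using assms(3)
  proof (induction J rule: infinite_finite_induct)
    case (insert i J)
    have w: "(\<lambda>x. a i * w i x) \<in> W" "w i \<in> W"
      using func.subspace_scale[OF assms(2)] insert.prems by auto
    moreover have "(\<lambda>x. \<Sum>j\<in>insert i J. a j * w j x) = (\<lambda>x. a i * w i x) + (\<lambda>x. \<Sum>j\<in>J. a j * w j x)"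
      using insert.hyps by (simp add: fun_eq_iff)
    ultimately show ?case
      using insert assms(1) func.subspace_add[OF assms(2)] by (simp add: linear_form_on_def)
  qed (simp_all add: zero)
qed

text \<open>The linear coefficient of a product along a ray is linear in \<open>w\<close> only
  because the constant term, the value at the origin, is the same \<open>c\<close> on all rays;
  hence \<open>c\<close> is part of the induction.\<close>

lemma polynomial_functions_linear_part:
  assumes "F \<in> polynomial_functions W"
  shows "\<exists>\<phi> c. linear_form_on W \<phi> \<and> (\<forall>w\<in>W. \<exists>P. (\<forall>t. poly P t = F (\<lambda>x. t * w x))
    \<and> Polynomial.coeff P 0 = c \<and> Polynomial.coeff P 1 = \<phi> w)"
  using assms
proof induction
  case (const c)
  show ?case
    by (intro exI[of _ "\<lambda>_. 0"] exI[of _ c] conjI ballI exI[of _ "[:c:]"]) (simp_all add: linear_form_on_def)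
next
  case (linear \<phi>)
  then show ?case
    by (intro exI[of _ \<phi>] exI[of _ 0] conjI ballI exI[of _ "[:0, \<phi> _:]"]) (simp_all add: linear_form_on_def)
next
  case (add F H)
  obtain \<phi> c where F: "linear_form_on W \<phi>" "\<forall>w\<in>W. \<exists>P. (\<forall>t. poly P t = F (\<lambda>x. t * w x))
    \<and> Polynomial.coeff P 0 = c \<and> Polynomial.coeff P 1 = \<phi> w" using add.IH(1) by blast
  obtain \<psi> d where H: "linear_form_on W \<psi>" "\<forall>w\<in>W. \<exists>P. (\<forall>t. poly P t = H (\<lambda>x. t * w x))
    \<and> Polynomial.coeff P 0 = d \<and> Polynomial.coeff P 1 = \<psi> w" using add.IH(2) by blast
  show ?case
  proof (intro exI[of _ "\<lambda>w. \<phi> w + \<psi> w"] exI[of _ "c + d"] conjI ballI)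
    show "linear_form_on W (\<lambda>w. \<phi> w + \<psi> w)"
      using F(1) H(1) by (simp add: linear_form_on_def algebra_simps)
    fix w assume "w \<in> W"
    then obtain P R where "\<forall>t. poly P t = F (\<lambda>x. t * w x)" "Polynomial.coeff P 0 = c" "Polynomial.coeff P 1 = \<phi> w"
      "\<forall>t. poly R t = H (\<lambda>x. t * w x)" "Polynomial.coeff R 0 = d" "Polynomial.coeff R 1 = \<psi> w"
      using F(2) H(2) by metis
    then show "\<exists>P. (\<forall>t. poly P t = F (\<lambda>x. t * w x) + H (\<lambda>x. t * w x))
        \<and> Polynomial.coeff P 0 = c + d \<and> Polynomial.coeff P 1 = \<phi> w + \<psi> w"
      by (intro exI[of _ "P + R"]) simp
  qed
next
  case (mult F H)
  obtain \<phi> c where F: "linear_form_on W \<phi>" "\<forall>w\<in>W. \<exists>P. (\<forall>t. poly P t = F (\<lambda>x. t * w x))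
    \<and> Polynomial.coeff P 0 = c \<and> Polynomial.coeff P 1 = \<phi> w" using mult.IH(1) by blast
  obtain \<psi> d where H: "linear_form_on W \<psi>" "\<forall>w\<in>W. \<exists>P. (\<forall>t. poly P t = H (\<lambda>x. t * w x))
    \<and> Polynomial.coeff P 0 = d \<and> Polynomial.coeff P 1 = \<psi> w" using mult.IH(2) by blast
  show ?case
  proof (intro exI[of _ "\<lambda>w. c * \<psi> w + \<phi> w * d"] exI[of _ "c * d"] conjI ballI)
    show "linear_form_on W (\<lambda>w. c * \<psi> w + \<phi> w * d)"
      using F(1) H(1) by (simp add: linear_form_on_def algebra_simps)
    fix w assume "w \<in> W"
    then obtain P R where "\<forall>t. poly P t = F (\<lambda>x. t * w x)" "Polynomial.coeff P 0 = c" "Polynomial.coeff P 1 = \<phi> w"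
      "\<forall>t. poly R t = H (\<lambda>x. t * w x)" "Polynomial.coeff R 0 = d" "Polynomial.coeff R 1 = \<psi> w"
      using F(2) H(2) by metis
    then show "\<exists>P. (\<forall>t. poly P t = F (\<lambda>x. t * w x) * H (\<lambda>x. t * w x))
        \<and> Polynomial.coeff P 0 = c * d \<and> Polynomial.coeff P 1 = c * \<psi> w + \<phi> w * d"
      by (intro exI[of _ "P * R"]) (simp add: coeff_mult)
  qed
qed

text \<open>Agreement with \<open>t * y\<close> at infinitely many \<open>t\<close> identifies
  \<open>y\<close> with the linear part of \<open>F\<close>. The value \<open>t = 0\<close> is left
  out since only nonzero multiples of a point are known to stay in the orbit.\<close>

lemma linear_form_of_homogeneous_values:
  assumes "F \<in> polynomial_functions W"
  shows "\<exists>\<phi>. linear_form_on W \<phi> \<and>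
    (\<forall>w\<in>W. \<forall>y. (\<forall>t. t \<noteq> 0 \<longrightarrow> F (\<lambda>x. t * w x) = t * y) \<longrightarrow> \<phi> w = y)"
proof -
  obtain \<phi> c where \<phi>: "linear_form_on W \<phi>" "\<forall>w\<in>W. \<exists>P. (\<forall>t. poly P t = F (\<lambda>x. t * w x))
    \<and> Polynomial.coeff P 0 = c \<and> Polynomial.coeff P 1 = \<phi> w"
    using polynomial_functions_linear_part[OF assms] by blast
  have "\<phi> w = y" if w: "w \<in> W" and y: "\<And>t. t \<noteq> 0 \<Longrightarrow> F (\<lambda>x. t * w x) = t * y" for w y
  proof -
    obtain P where P: "\<forall>t. poly P t = F (\<lambda>x. t * w x)" "Polynomial.coeff P 1 = \<phi> w"
      using \<phi>(2) w by blast
    have "P - [:0, y:] = 0"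
    proof (rule ccontr)
      assume "P - [:0, y:] \<noteq> 0"
      then have "finite {t. poly (P - [:0, y:]) t = 0}" by (rule poly_roots_finite)
      moreover have "UNIV - {0} \<subseteq> {t. poly (P - [:0, y:]) t = 0}" using P(1) y by auto
      ultimately have "finite (UNIV - {0 :: complex})" by (rule finite_subset[rotated])
      then show False by (simp add: infinite_UNIV_char_0)
    qed
    then show ?thesis using P(2) by simp
  qed
  then show ?thesis using \<phi>(1) by (intro exI[of _ \<phi>] conjI ballI allI impI) simp_all
qed

text \<open>Normality turns the integral fraction \<open>A / D\<close> into a polynomial function.
  All conditions are imposed on the dense set \<open>B\<close> only; \<open>zero\<close> makes
  \<open>A\<close> a multiple of \<open>D\<close> at each of its points, also where \<open>D\<close>
  vanishes.\<close>

lemma normal_affine_variety_fraction: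
  fixes W :: "('a \<Rightarrow> complex) set" and A D :: "('a \<Rightarrow> complex) \<Rightarrow> complex"
    and q :: "nat \<Rightarrow> ('a \<Rightarrow> complex) \<Rightarrow> complex"
  assumes normal: "normal_affine_variety W (zariski_closure W B)" and B: "B \<subseteq> W"
    and poly: "A \<in> polynomial_functions W" "D \<in> polynomial_functions W"
      "\<And>k. q k \<in> polynomial_functions W"
    and monic: "q 0 = (\<lambda>_. 1)"
    and zero: "\<And>w. w \<in> B \<Longrightarrow> D w = 0 \<Longrightarrow> A w = 0"
    and integral_eq: "\<And>w. w \<in> B \<Longrightarrow> D w \<noteq> 0 \<Longrightarrow> (\<Sum>k\<le>m. q k w * (A w / D w) ^ (m - k)) = 0"
    and nz: "\<exists>w\<in>B. D w \<noteq> 0"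
  shows "\<exists>H\<in>polynomial_functions W. \<forall>w\<in>B. D w \<noteq> 0 \<longrightarrow> H w = A w / D w"
proof -
  define Z where "Z = zariski_closure W B"
  define R where "R = coordinate_ring W Z"
  have BZ: "B \<subseteq> Z" using B by (auto simp: Z_def zariski_closure_def)
  have dom: "domain R" and closed: "\<And>x. integral_over (frac_field R) (to_frac R ` carrier R) x
      \<Longrightarrow> x \<in> to_frac R ` carrier R"
    using normal by (auto simp: normal_affine_variety_def integrally_closed_domain_def R_def Z_def)
  interpret domain R by (rule dom)
  have carrier: "carrier R = (\<lambda>F. restrict F Z) ` polynomial_functions W"
    by (simp add: R_def coordinate_ring_def)
  have ops: "(f \<otimes>\<^bsub>R\<^esub> h) z = f z * h z" "(f \<oplus>\<^bsub>R\<^esub> h) z = f z + h z" "\<one>\<^bsub>R\<^esub> z = 1" "\<zero>\<^bsub>R\<^esub> z = 0"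
    if "z \<in> Z" for f h z
    using that by (simp_all add: R_def coordinate_ring_def)
  have pow: "(f [^]\<^bsub>R\<^esub> k) z = f z ^ k" if "z \<in> Z" for f z and k :: nat
    using that by (induction k) (simp_all add: ops)
  \<comment> \<open>\<open>B\<close> is Zariski dense in \<open>Z\<close>, so identities in the
    coordinate ring may be checked on \<open>B\<close>.\<close>
  have eq_zero: "f = \<zero>\<^bsub>R\<^esub>" if f: "f \<in> carrier R" and B0: "\<And>z. z \<in> B \<Longrightarrow> f z = 0" for f
  proof -
    obtain F where F: "F \<in> polynomial_functions W" "f = restrict F Z" using f carrier by auto
    then have "\<forall>z\<in>B. F z = 0" using B0 BZ by force
    then have "F z = 0" if "z \<in> Z" for z using that F(1) by (auto simp: Z_def zariski_closure_def)
    then show ?thesis by (auto simp: F(2) R_def coordinate_ring_def)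
  qed
  define a d where "a = restrict A Z" and "d = restrict D Z"
  define qs where "qs = map (\<lambda>k. restrict (q k) Z) [0..<Suc m]"
  have a: "a \<in> carrier R" and d: "d \<in> carrier R" and qs: "set qs \<subseteq> carrier R"
    using poly by (auto simp: a_def d_def qs_def carrier)
  obtain w0 where "w0 \<in> B" "D w0 \<noteq> 0" using nz by blast
  then have "d w0 \<noteq> \<zero>\<^bsub>R\<^esub> w0" using BZ by (auto simp: d_def ops)
  then have "d \<noteq> \<zero>\<^bsub>R\<^esub>" by auto
  with d have d': "d \<in> carrier R - {\<zero>\<^bsub>R\<^esub>}" by simp
  \<comment> \<open>\<open>y\<close> stands for the quotient; asking only for
    \<open>a z = y * d z\<close> covers the zeros of \<open>d\<close> as well.\<close>
  have numerator: "eval_numerator R a d ps z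
      = d z ^ length ps * (\<Sum>i<length ps. (ps ! i) z * y ^ (length ps - Suc i))"
    if "z \<in> Z" "a z = y * d z" for z y ps
    using that
  proof (induction ps)
    case (Cons p ps)
    then show ?case
      by (simp add: ops pow sum.lessThan_Suc_shift power_mult_distrib algebra_simps del: sum.lessThan_Suc)
  qed (simp add: ops)
  have "eval_numerator R a d qs = \<zero>\<^bsub>R\<^esub>"
  proof (rule eq_zero)
    show "eval_numerator R a d qs \<in> carrier R" using a d qs by (rule eval_numerator_closed)
    fix z assume z: "z \<in> B"
    then have zZ: "z \<in> Z" using BZ by auto
    then have az: "a z = A z / D z * d z" using zero[OF z] by (auto simp: a_def d_def)
    have "(\<Sum>i<length qs. (qs ! i) z * (A z / D z) ^ (length qs - Suc i))
        = (\<Sum>k\<le>m. q k z * (A z / D z) ^ (m - k))"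
      using zZ unfolding lessThan_Suc_atMost[symmetric]
      by (intro sum.cong) (auto simp: qs_def simp del: upt_Suc)
    \<comment> \<open>Where \<open>D z = 0\<close>, the factor \<open>d z ^ length qs\<close>
      vanishes, its exponent being \<open>Suc m\<close>.\<close>
    then show "eval_numerator R a d qs z = 0"
      unfolding numerator[OF zZ az] using integral_eq[OF z] zZ
      by (cases "D z = 0") (simp_all add: d_def qs_def)
  qed
  moreover have "qs \<noteq> []" "hd qs = \<one>\<^bsub>R\<^esub>"
    using monic by (simp_all add: qs_def R_def coordinate_ring_def upt_rec)
  ultimately have "fraction R a d \<in> to_frac R ` carrier R"
    using closed integral_over_fraction[OF a d' qs] by blast
  then obtain f where f: "f \<in> carrier R" "fraction R a d = fraction R f \<one>\<^bsub>R\<^esub>"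
    by (auto simp: to_frac_def)
  then have afd: "a = f \<otimes>\<^bsub>R\<^esub> d"
    using fraction_eq_iff[of a d f "\<one>\<^bsub>R\<^esub>"] a d' by simp
  obtain H where H: "H \<in> polynomial_functions W" "f = restrict H Z" using f(1) carrier by auto
  have "H w = A w / D w" if "w \<in> B" "D w \<noteq> 0" for w
  proof -
    have "w \<in> Z" using that BZ by auto
    then have "A w = H w * D w"
      using fun_cong[OF afd, of w] by (simp add: ops a_def d_def H(2))
    then show ?thesis using that by simp
  qed
  then show ?thesis using H(1) by blast
qed

section \<open>Coefficients along a line\<close>

text \<open>Lagrange interpolation, with weights independent of \<open>T\<close>. It serves both for
  coefficients along a line of matrices and for coefficients in the deformation parameter.\<close>

lemma coefficient_functional:
  fixes x :: "nat \<Rightarrow> 'a::field"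
  assumes inj: "inj_on x {..m}"
  shows "\<exists>\<Lambda>. \<forall>T i. Polynomial.degree T \<le> m \<longrightarrow>
    (\<Sum>j\<le>m. \<Lambda> i j * poly T (x j)) = Polynomial.coeff T i"
proof -
  define L where "L = (\<lambda>j. Polynomial.smult (1 / (\<Prod>l\<in>{..m} - {j}. x j - x l)) (\<Prod>l\<in>{..m} - {j}. [:- x l, 1:]))"
  have pL: "poly (L j) (x k) = (if k = j then 1 else 0)" if "j \<le> m" "k \<le> m" for j k
  proof -
    have "(\<Prod>l\<in>{..m} - {j}. x j - x l) \<noteq> 0" using that inj by (auto simp: inj_on_def)
    moreover have "(\<Prod>l\<in>{..m} - {j}. x k - x l) = 0" if "k \<noteq> j"
      using that \<open>k \<le> m\<close> by (intro prod_zero) auto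
    ultimately show ?thesis by (auto simp: L_def poly_prod)
  qed
  have degL: "Polynomial.degree (L j) \<le> m" if "j \<le> m" for j
  proof -
    have "Polynomial.degree (\<Prod>l\<in>{..m} - {j}. [:- x l, 1:]) \<le> (\<Sum>l\<in>{..m} - {j}. Polynomial.degree [:- x l, 1:])"
      by (rule degree_prod_sum_le[unfolded o_def]) simp
    also have "\<dots> = m" using that by simp
    finally show ?thesis by (simp add: L_def)
  qed
  have "(\<Sum>j\<le>m. Polynomial.coeff (L j) i * poly T (x j)) = Polynomial.coeff T i"
    if T: "Polynomial.degree T \<le> m" for T i
  proof -
    define V where "V = (\<Sum>j\<le>m. Polynomial.smult (poly T (x j)) (L j)) - T"
    have "poly V (x k) = 0" if "k \<le> m" for k
      using that by (simp add: V_def poly_sum pL if_distrib sum.delta cong: if_cong)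
    then have sub: "x ` {..m} \<subseteq> {y. poly V y = 0}" by auto
    have degV: "Polynomial.degree V \<le> m"
      unfolding V_def using T degL
      by (intro degree_diff_le degree_sum_le) (auto intro: order.trans[OF degree_smult_le])
    have "V = 0"
    proof (rule ccontr)
      assume "V \<noteq> 0"
      then have "card {y. poly V y = 0} \<le> m" using card_poly_roots_bound[of V] degV by linarith
      moreover have "card (x ` {..m}) \<le> card {y. poly V y = 0}"
        using \<open>V \<noteq> 0\<close> sub by (intro card_mono poly_roots_finite)
      ultimately show False using card_image[OF inj] by simp
    qed
    then have "T = (\<Sum>j\<le>m. Polynomial.smult (poly T (x j)) (L j))" by (simp add: V_def)
    then have "Polynomial.coeff T i = Polynomial.coeff (\<Sum>j\<le>m. Polynomial.smult (poly T (x j)) (L j)) i" by simp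
    then show ?thesis by (simp add: coeff_sum mult.commute)
  qed
  then show ?thesis by (intro exI[of _ "\<lambda>i j. Polynomial.coeff (L j) i"] allI impI)
qed

text \<open>Fixed combinations of the values at \<open>m + 1\<close> points of the line are linear
  in \<open>w\<close> even for functions that are not polynomial there. Counting down from degree
  \<open>m\<close> makes \<open>c 0\<close> the coefficient of degree \<open>m\<close>.\<close>

lemma line_coefficients:
  fixes u v :: "'m::finite endo"
  shows "\<exists>c. (\<forall>k W. linear_form_on W (c k)) \<and> (\<forall>k w P. (\<forall>x. poly P x = w (x *s u + v)) \<longrightarrow>
    Polynomial.degree P \<le> m \<longrightarrow> c k w = Polynomial.coeff P (m - k))"
proof -
  have "inj_on (of_nat :: nat \<Rightarrow> complex) {..m}" by (simp add: inj_on_def)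
  from coefficient_functional[OF this] obtain \<Lambda> :: "nat \<Rightarrow> nat \<Rightarrow> complex"
    where \<Lambda>: "\<forall>T i. Polynomial.degree T \<le> m \<longrightarrow>
      (\<Sum>j\<le>m. \<Lambda> i j * poly T (of_nat j)) = Polynomial.coeff T i" ..
  show ?thesis
  proof (intro exI[of _ "\<lambda>k w. \<Sum>j\<le>m. \<Lambda> (m - k) j * w (of_nat j *s u + v)"] conjI allI impI)
    show "linear_form_on W (\<lambda>w. \<Sum>j\<le>m. \<Lambda> (m - k) j * w (of_nat j *s u + v))" for k W
      by (simp add: linear_form_on_def sum.distrib sum_distrib_left algebra_simps)
    show "(\<Sum>j\<le>m. \<Lambda> (m - k) j * w (of_nat j *s u + v)) = Polynomial.coeff P (m - k)"
      if "\<forall>x. poly P x = w (x *s u + v)" "Polynomial.degree P \<le> m" for k w P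
      using \<Lambda>[rule_format, of P "m - k"] that by simp
  qed
qed

section \<open>The padded permanent along linear maps\<close>

lemma entry_linear:
  assumes "Vector_Spaces.linear (*s) (*s) (h :: 'm::finite endo \<Rightarrow> 'm endo)"
  shows "Vector_Spaces.linear (*s) (*) (\<lambda>M. entry e (h M) i j)"
  using assms by (auto simp: Vector_Spaces.linear_iff entry_def vector_space_over_itself.vector_space_axioms)

lemma padded_perm_linear_in_forms:
  fixes e :: "nat \<Rightarrow> 'm::finite"
  assumes h: "Vector_Spaces.linear (*s) (*s) (h :: 'm endo \<Rightarrow> 'm endo)" and n: "n \<le> m"
  shows "(\<lambda>M. padded_perm e m n (h M)) \<in> forms m"
proof -
  \<comment> \<open>The \<open>m\<close> linear factors of one term: \<open>m - n\<close> copies of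
    the corner entry, then one entry from each row \<open>Suc k\<close> with \<open>k\<close> from
    \<open>m - n\<close> to \<open>m - 1\<close>.\<close>
  define \<psi> where "\<psi> = (\<lambda>\<sigma> k M. if k < m - n then entry e (h M) 1 1 else entry e (h M) (Suc k) (\<sigma> (Suc k)))"
  have sum_fun: "(\<lambda>M. \<Sum>\<sigma>\<in>A. f \<sigma> M) = (\<Sum>\<sigma>\<in>A. f \<sigma>)" for A and f :: "(nat \<Rightarrow> nat) \<Rightarrow> 'm endo \<Rightarrow> complex"
    by (induction A rule: infinite_finite_induct) (auto simp: fun_eq_iff)
  have prod: "(\<Prod>k<m. \<psi> \<sigma> k M) = entry e (h M) 1 1 ^ (m - n) * (\<Prod>i=m - n + 1..m. entry e (h M) i (\<sigma> i))" for \<sigma> M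
  proof -
    have "(\<Prod>k<m. \<psi> \<sigma> k M) = (\<Prod>k\<in>{..<m - n}. \<psi> \<sigma> k M) * (\<Prod>k\<in>{m - n..<m}. \<psi> \<sigma> k M)"
      using n by (subst prod.union_disjoint[symmetric]) (auto intro!: prod.cong)
    also have "(\<Prod>k\<in>{..<m - n}. \<psi> \<sigma> k M) = entry e (h M) 1 1 ^ (m - n)"
      by (simp add: \<psi>_def)
    also have "(\<Prod>k\<in>{m - n..<m}. \<psi> \<sigma> k M) = (\<Prod>i=m - n + 1..m. entry e (h M) i (\<sigma> i))"
      by (intro prod.reindex_bij_witness[of _ "\<lambda>i. i - 1" Suc]) (auto simp: \<psi>_def)
    finally show ?thesis .
  qed
  have "(\<lambda>M. padded_perm e m n (h M))
      = (\<Sum>\<sigma> | \<sigma> permutes {m - n + 1..m}. (\<lambda>M. \<Prod>k<m. \<psi> \<sigma> k M))"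
    unfolding sum_fun[symmetric] padded_perm_def permanent_def sum_distrib_left prod ..
  also have "\<dots> \<in> forms m"
    unfolding forms_def
  proof (intro func.span_sum func.span_base)
    fix \<sigma>
    have "\<forall>k<m. Vector_Spaces.linear (*s) (*) (\<psi> \<sigma> k)"
    proof (intro allI impI)
      show "Vector_Spaces.linear (*s) (*) (\<psi> \<sigma> k)" for k
        by (cases "k < m - n") (simp_all add: \<psi>_def entry_linear[OF h])
    qed
    then show "(\<lambda>M. \<Prod>k<m. \<psi> \<sigma> k M) \<in> {\<lambda>M. \<Prod>k<m. \<phi> k M |\<phi>. \<forall>k<m. Vector_Spaces.linear (*s) (*) (\<phi> k)}"
      by blast
  qed
  finally show ?thesis .
qed

lemma padded_perm_on_line:
  fixes e :: "nat \<Rightarrow> 'm::finite"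
  assumes h: "Vector_Spaces.linear (*s) (*s) (h :: 'm endo \<Rightarrow> 'm endo)" and n: "n \<le> m"
  shows "\<exists>F. Polynomial.degree F \<le> n \<and> (\<forall>x. padded_perm e m n (h (x *s u + v))
       = poly ([:entry e (h v) 1 1, entry e (h u) 1 1:] ^ (m - n) * F) x)"
proof -
  define I where "I = {m - n + 1..m}"
  define F where "F = (\<Sum>\<sigma> | \<sigma> permutes I. \<Prod>i\<in>I. [:entry e (h v) i (\<sigma> i), entry e (h u) i (\<sigma> i):])"
  have card: "card I = n" and fin: "finite I" using n by (simp_all add: I_def)
  have entry: "entry e (h (x *s u + v)) i j = poly [:entry e (h v) i j, entry e (h u) i j:] x" for x i j
    using h by (simp add: Vector_Spaces.linear_iff entry_def)
  have "Polynomial.degree F \<le> n"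
    unfolding F_def
  proof (intro degree_sum_le finite_permutations fin)
    fix \<sigma>
    have "Polynomial.degree (\<Prod>i\<in>I. [:entry e (h v) i (\<sigma> i), entry e (h u) i (\<sigma> i):])
        \<le> (\<Sum>i\<in>I. Polynomial.degree [:entry e (h v) i (\<sigma> i), entry e (h u) i (\<sigma> i):])"
      using fin by (rule degree_prod_sum_le[unfolded o_def])
    also have "\<dots> \<le> (\<Sum>i\<in>I. 1)" by (intro sum_mono) simp
    finally show "Polynomial.degree (\<Prod>i\<in>I. [:entry e (h v) i (\<sigma> i), entry e (h u) i (\<sigma> i):]) \<le> n"
      by (simp add: card)
  qed
  moreover have "padded_perm e m n (h (x *s u + v))
       = poly ([:entry e (h v) 1 1, entry e (h u) 1 1:] ^ (m - n) * F) x" for x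
    unfolding padded_perm_def permanent_def entry poly_mult poly_power F_def poly_sum poly_prod I_def ..
  ultimately show ?thesis by blast
qed

text \<open>On the line \<open>x u + v\<close> the padded permanent composed with \<open>h\<close> is \<open>(a x + b)\<close> to the power
  \<open>m - n\<close> times a cofactor. Multiplied by the leading coefficient, the root \<open>- b / a\<close> is integral
  over the coefficients, and as a root of higher multiplicity it is a rational function of them.\<close>

lemma normal_imp_root_polynomial:
  fixes u v :: "'m::finite endo" and e :: "nat \<Rightarrow> 'm"
  assumes normal: "normal_affine_variety (forms m) (zariski_closure (forms m) B)"
    and n: "n \<le> m" "m - n \<ge> 2"
    and B: "\<And>w. w \<in> B \<Longrightarrow> \<exists>h. Vector_Spaces.linear (*s) (*s) h \<and> w = (\<lambda>M. padded_perm e m n (h M))"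
    and good: "w\<^sub>0 \<in> B" "\<And>x. poly P\<^sub>0 x = w\<^sub>0 (x *s u + v)" "Polynomial.coeff P\<^sub>0 m \<noteq> 0"
      "card {x. poly P\<^sub>0 x = 0} = Suc n"
  shows "\<exists>H\<in>polynomial_functions (forms m). \<forall>h P. Vector_Spaces.linear (*s) (*s) h \<longrightarrow>
    (\<lambda>M. padded_perm e m n (h M)) \<in> B \<longrightarrow> (\<forall>x. poly P x = padded_perm e m n (h (x *s u + v))) \<longrightarrow>
    Polynomial.coeff P m \<noteq> 0 \<longrightarrow> card {x. poly P x = 0} = Suc n \<longrightarrow>
    H (\<lambda>M. padded_perm e m n (h M))
      = - (Polynomial.coeff P m * entry e (h v) 1 1 / entry e (h u) 1 1)"
proof -
  let ?W = "forms m :: ('m endo \<Rightarrow> complex) set"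
  let ?p = "\<lambda>h M. padded_perm e m n (h M)"
  define r where "r = m - n"
  have m: "r + n = m" and r0: "r > 0" "r \<noteq> 1" using n by (auto simp: r_def)
  \<comment> \<open>Here \<open>m - n \<ge> 2\<close> enters: the power sums only yield
    \<open>r - 1\<close> times the root, and this factor is divided out in \<open>A\<close>.\<close>
  then have r: "r > 0" "of_nat r - 1 \<noteq> (0 :: complex)" by simp_all
  obtain c :: "nat \<Rightarrow> ('m endo \<Rightarrow> complex) \<Rightarrow> complex" where c: "\<forall>k W. linear_form_on W (c k)"
    "\<forall>k w P. (\<forall>x. poly P x = w (x *s u + v)) \<longrightarrow> Polynomial.degree P \<le> m \<longrightarrow>
      c k w = Polynomial.coeff P (m - k)"
    using line_coefficients[of u v m] by blast
  define q where "q = (\<lambda>k w. normalized_coeffs m (\<lambda>k. c k w) k)"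
  define s where "s = (\<lambda>w. newton_seq m (\<lambda>k. q k w))"
  \<comment> \<open>The extra factor \<open>c 0 w\<close> in \<open>D\<close> and \<open>A\<close>
    cancels in the quotient but ensures that \<open>D w \<noteq> 0\<close> implies a nonzero leading
    coefficient, without which the rescaling fails.\<close>
  define D where "D = (\<lambda>w. c 0 w * hankel_det n (s w))"
  define A where "A = (\<lambda>w. c 0 w * ((s w 1 * hankel_det n (s w) - hankel_det_shift n (s w)) * (1 / (of_nat r - 1))))"
  have poly_c: "c k \<in> polynomial_functions ?W" for k
    using c(1) by (intro polynomial_functions.linear) blast
  have poly_q: "q k \<in> polynomial_functions ?W" for k
    unfolding q_def normalized_coeffs_def
    by (cases "k = 0"; cases "k \<le> m") (auto intro!: polynomial_functions_intros poly_c)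
  have poly_s: "(\<lambda>w. s w k) \<in> polynomial_functions ?W" for k
    unfolding s_def by (intro polynomial_functions_newton_seq poly_q)
  note poly_hankel = polynomial_functions_hankel_det[of "\<lambda>k w. s w k", OF poly_s]
    polynomial_functions_hankel_det_shift[of "\<lambda>k w. s w k", OF poly_s]
  have poly_A: "A \<in> polynomial_functions ?W" and poly_D: "D \<in> polynomial_functions ?W"
    unfolding A_def D_def by (intro polynomial_functions_intros poly_c poly_s poly_hankel)+
  define \<rho> where "\<rho> = (\<lambda>h w. - (c 0 w * entry e (h v) 1 1 / entry e (h u) 1 1))"
  have facts: "P = P' \<and> c k (?p h) = Polynomial.coeff P (m - k) \<and>
      A (?p h) = \<rho> h (?p h) * D (?p h) \<and>
      (c 0 (?p h) \<noteq> 0 \<longrightarrow> (\<Sum>k\<le>m. q k (?p h) * \<rho> h (?p h) ^ (m - k)) = 0 \<and>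
        (card {x. poly P x = 0} = Suc n \<longrightarrow> D (?p h) \<noteq> 0))"
    if h: "Vector_Spaces.linear (*s) (*s) h" and P: "\<And>x. poly P x = ?p h (x *s u + v)"
      "\<And>x. poly P' x = ?p h (x *s u + v)" for h P P' k
  proof -
    let ?a = "entry e (h u) 1 1" and ?b = "entry e (h v) 1 1" and ?w = "?p h"
    obtain F where F: "Polynomial.degree F \<le> n" "\<forall>x. ?p h (x *s u + v) = poly ([:?b, ?a:] ^ r * F) x"
      unfolding r_def using padded_perm_on_line[OF h n(1)] by blast
    have PF: "P = [:?b, ?a:] ^ r * F" and PP: "P = P'"
      by (intro poly_eq_poly_eq_iff[THEN iffD1] ext, simp only: P F(2)[rule_format])+
    have "Polynomial.degree P \<le> Polynomial.degree ([:?b, ?a:] ^ r) + Polynomial.degree F"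
      unfolding PF by (rule degree_mult_le)
    also have "Polynomial.degree ([:?b, ?a:] ^ r) \<le> Polynomial.degree [:?b, ?a:] * r"
      by (rule degree_power_le)
    finally have degP: "Polynomial.degree P \<le> m"
      using F(1) m by (auto split: if_splits)
    have cP: "c k ?w = Polynomial.coeff P (m - k)" for k
      using c(2)[rule_format, of P ?w k] P(1) degP by simp
    have A0: "A ?w = \<rho> h ?w * D ?w"
      and rest: "c 0 ?w \<noteq> 0 \<Longrightarrow> (\<Sum>k\<le>m. q k ?w * \<rho> h ?w ^ (m - k)) = 0"
        "c 0 ?w \<noteq> 0 \<Longrightarrow> card {x. poly P x = 0} = Suc n \<Longrightarrow> D ?w \<noteq> 0"
    proof -
      note root = normalized_root_rational[OF PF F(1) r(1), unfolded m, folded cP]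
        normalized_root_integral[OF PF F(1) r(1), unfolded m, folded cP]
        normalized_hankel_det_nonzero[OF PF F(1) r(1), unfolded m, folded cP]
      have s: "newton_seq m (normalized_coeffs m (\<lambda>k. c k ?w)) = s ?w"
        by (simp add: s_def q_def)
      have \<rho>: "- (c 0 ?w * ?b / ?a) = \<rho> h ?w" by (simp add: \<rho>_def)
      show "A ?w = \<rho> h ?w * D ?w"
      proof (cases "c 0 ?w = 0")
        case False
        have eq: "(of_nat r - 1) * \<rho> h ?w * hankel_det n (s ?w)
            = s ?w 1 * hankel_det n (s ?w) - hankel_det_shift n (s ?w)"
          using root(1)[OF False] unfolding s \<rho> .
        have "(s ?w 1 * hankel_det n (s ?w) - hankel_det_shift n (s ?w)) * (1 / (of_nat r - 1))
            = \<rho> h ?w * hankel_det n (s ?w)"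
          unfolding eq[symmetric] using r(2) by simp
        then show ?thesis unfolding A_def D_def by (simp only: mult.left_commute)
      qed (simp add: A_def D_def)
      assume c0: "c 0 ?w \<noteq> 0"
      show "(\<Sum>k\<le>m. q k ?w * \<rho> h ?w ^ (m - k)) = 0"
        using root(2)[OF c0] unfolding \<rho> q_def .
      show "D ?w \<noteq> 0" if "card {x. poly P x = 0} = Suc n"
        using root(3)[OF c0 that] c0 unfolding s by (simp add: D_def)
    qed
    then show ?thesis using PP cP by blast
  qed
  have ex_P: "\<exists>P. \<forall>x. poly P x = ?p h (x *s u + v)" if "Vector_Spaces.linear (*s) (*s) h" for h
    using padded_perm_on_line[OF that n(1), of e u v] by metis
  have sub: "B \<subseteq> ?W"
    using B padded_perm_linear_in_forms[OF _ n(1)] by blast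
  have "\<exists>H\<in>polynomial_functions ?W. \<forall>w\<in>B. D w \<noteq> 0 \<longrightarrow> H w = A w / D w"
  proof (rule normal_affine_variety_fraction[OF normal sub poly_A poly_D poly_q])
    show "q 0 = (\<lambda>_. 1)" by (simp add: q_def normalized_coeffs_def)
    fix w assume "w \<in> B"
    then obtain h where h: "Vector_Spaces.linear (*s) (*s) h" "w = ?p h" using B by blast
    obtain P where P: "\<And>x. poly P x = ?p h (x *s u + v)" using ex_P[OF h(1)] by blast
    note f = facts[OF h(1) P P]
    show "A w = 0" if "D w = 0" using f that by (simp add: h(2))
    assume D: "D w \<noteq> 0"
    then have "c 0 w \<noteq> 0" by (auto simp: D_def)
    moreover have "A w / D w = \<rho> h w" using f D by (simp add: h(2))
    ultimately show "(\<Sum>k\<le>m. q k w * (A w / D w) ^ (m - k)) = 0" using f by (simp add: h(2))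
  next
    obtain h where h: "Vector_Spaces.linear (*s) (*s) h" "w\<^sub>0 = ?p h" using B good(1) by blast
    have P: "poly P\<^sub>0 x = ?p h (x *s u + v)" for x using good(2) h(2) by simp
    show "\<exists>w\<in>B. D w \<noteq> 0"
      using facts[OF h(1) P P, of 0] good by (auto simp: h(2)[symmetric])
  qed
  then obtain H where H: "H \<in> polynomial_functions ?W" "\<And>w. w \<in> B \<Longrightarrow> D w \<noteq> 0 \<Longrightarrow> H w = A w / D w"
    by blast
  show ?thesis
  proof (intro bexI[OF _ H(1)] allI impI)
    fix h P
    assume h: "Vector_Spaces.linear (*s) (*s) h" "?p h \<in> B" and P: "\<forall>x. poly P x = ?p h (x *s u + v)"
      and c0: "Polynomial.coeff P m \<noteq> 0" and card: "card {x. poly P x = 0} = Suc n"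
    have f: "c 0 (?p h) = Polynomial.coeff P (m - 0)" "A (?p h) = \<rho> h (?p h) * D (?p h)" "D (?p h) \<noteq> 0"
      using facts[OF h(1), of P P 0] P c0 card by auto
    then show "H (?p h) = - (Polynomial.coeff P m * entry e (h v) 1 1 / entry e (h u) 1 1)"
      using H(2)[OF h(2)] by (simp add: \<rho>_def)
  qed
qed

section \<open>A one-parameter family in the orbit\<close>

lemma span_axis:
  "vec.span ((\<lambda>x. axis x 1) ` A) = {M :: 'a::field ^ 'n::finite. \<forall>x. x \<notin> A \<longrightarrow> M $ x = 0}"
proof
  show "vec.span ((\<lambda>x. axis x 1) ` A) \<subseteq> {M :: 'a ^ 'n. \<forall>x. x \<notin> A \<longrightarrow> M $ x = 0}"
    by (rule vec.span_minimal) (auto simp: axis_def vec.subspace_def)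
  show "{M :: 'a ^ 'n. \<forall>x. x \<notin> A \<longrightarrow> M $ x = 0} \<subseteq> vec.span ((\<lambda>x. axis x 1) ` A)"
  proof
    fix M :: "'a ^ 'n" assume M: "M \<in> {M. \<forall>x. x \<notin> A \<longrightarrow> M $ x = 0}"
    have "M = (\<Sum>x\<in>A. M $ x *s axis x 1)"
      using M by (auto simp: Finite_Cartesian_Product.vec_eq_iff axis_def if_distrib sum.delta cong: if_cong)
    moreover have "\<dots> \<in> vec.span ((\<lambda>x. axis x 1) ` A)"
      by (intro vec.span_sum vec.span_scale vec.span_base) auto
    ultimately show "M \<in> vec.span ((\<lambda>x. axis x 1) ` A)" by simp
  qed
qed

lemma span_matrix_unit:
  "vec.span (matrix_unit e ` A) = {M :: 'm::finite endo. \<forall>x. x \<notin> map_prod e e ` A \<longrightarrow> M $ x = 0}"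
proof -
  have "matrix_unit e ` A = (\<lambda>x. axis x 1) ` map_prod e e ` A"
    unfolding image_image by (intro image_cong) (auto simp: matrix_unit_def)
  then show ?thesis by (simp only: span_axis)
qed

lemma linear_inv_into:
  assumes "Vector_Spaces.linear s1 s2 h" "bij h"
  shows "Vector_Spaces.linear s2 s1 (inv_into UNIV h)"
proof -
  have vs: "vector_space s1" "vector_space s2" and add: "h (x + y) = h x + h y"
    and scale: "h (s1 c x) = s2 c (h x)" for x y c
    using assms(1) by (auto simp: Vector_Spaces.linear_iff)
  have surj: "h (inv_into UNIV h y) = y" and inj: "inv_into UNIV h (h x) = x" for x y
    using assms(2) by (simp_all add: bij_is_surj surj_f_inv_f bij_is_inj)
  have "inv_into UNIV h (x + y) = inv_into UNIV h x + inv_into UNIV h y" "inv_into UNIV h (s2 c x) = s1 c (inv_into UNIV h x)" for x y c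
    using inj[of "inv_into UNIV h x + inv_into UNIV h y"] inj[of "s1 c (inv_into UNIV h x)"] by (simp_all only: add scale surj)
  with vs show ?thesis by (simp add: Vector_Spaces.linear_iff)
qed

text \<open>Each block entry lies on \<open>(n - 1)!\<close> of the \<open>n!\<close> generalized
  diagonals, so this is the arithmetic mean of the block entries. It is written over permutations
  because the first order term of the permanent produces it in this form.\<close>

definition diagonal_mean :: "(nat \<Rightarrow> 'm::finite) \<Rightarrow> nat set \<Rightarrow> 'm endo \<Rightarrow> complex" where
  "diagonal_mean e I M = (\<Sum>\<sigma> | \<sigma> permutes I. \<Sum>i\<in>I. entry e M i (\<sigma> i)) / (of_nat (card I) * fact (card I))"

text \<open>\<open>\<epsilon>\<close> moves away from the degenerate substitution of the corner
  entry for everything in \<open>S\<close>, \<open>\<kappa>\<close> rescales, and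
  \<open>inv_into\<close> recovers the row number at which \<open>\<eta>\<close> is
  evaluated.\<close>

definition deformation ::
  "(nat \<Rightarrow> 'm::finite) \<Rightarrow> nat \<Rightarrow> nat \<Rightarrow> (nat \<Rightarrow> complex) \<Rightarrow> complex \<Rightarrow> complex \<Rightarrow> 'm endo \<Rightarrow> 'm endo" where
  "deformation e m n \<eta> \<kappa> \<epsilon> M = (\<chi> x. if x \<in> map_prod e e ` S_index m n
     then \<kappa> * (entry e M 1 1 + \<epsilon> * (if x = (e 1, e 1) then diagonal_mean e {m - n + 1..m} M
       else M $ x + \<eta> (inv_into {1..m} e (fst x)) * diagonal_mean e {m - n + 1..m} M))
     else M $ x)"

context
  fixes e :: "nat \<Rightarrow> 'm::finite" and m n :: nat and \<eta> :: "nat \<Rightarrow> complex"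
  assumes e: "bij_betw e {1..m} (UNIV :: 'm set)" and n: "n > 0" "n < m"
    and sum_\<eta>: "(\<Sum>i=m - n + 1..m. \<eta> i) = - of_nat m"
begin

abbreviation (input) "I \<equiv> {m - n + 1..m}"

section \<open>Invertibility of the deformation and its place in the group\<close>

lemma card_I: "card I = n" using n by simp

lemma card_permutes_I: "card {\<sigma>. \<sigma> permutes I} = fact n"
  by (rule card_permutations[OF card_I]) simp

lemma e_eq_iff: "i \<in> {1..m} \<Longrightarrow> j \<in> {1..m} \<Longrightarrow> e i = e j \<longleftrightarrow> i = j"
  by (rule inj_on_eq_iff[OF bij_betw_imp_inj_on[OF e]])

lemma entry_deformation_corner:
  "entry e (deformation e m n \<eta> \<kappa> \<epsilon> M) 1 1 = \<kappa> * (entry e M 1 1 + \<epsilon> * diagonal_mean e I M)"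
  by (simp add: entry_def deformation_def S_index_def)

lemma entry_deformation_block:
  assumes "i \<in> I" "j \<in> I"
  shows "entry e (deformation e m n \<eta> \<kappa> \<epsilon> M) i j
    = \<kappa> * (entry e M 1 1 + \<epsilon> * (entry e M i j + \<eta> i * diagonal_mean e I M))"
proof -
  have "(e i, e j) \<in> map_prod e e ` S_index m n"
    using assms by (force simp: S_index_def)
  moreover have "e i \<noteq> e 1" using assms n e_eq_iff[of i 1] by auto
  moreover have "inv_into {1..m} e (e i) = i"
    using assms e by (intro inv_into_f_f) (auto simp: bij_betw_def)
  ultimately show ?thesis by (simp add: entry_def deformation_def)
qed

lemma diagonal_mean_linear:
  "diagonal_mean e I (M + N) = diagonal_mean e I M + diagonal_mean e I N"
  "diagonal_mean e I (c *s M) = c * diagonal_mean e I M"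
  unfolding diagonal_mean_def entry_def
  by (simp_all add: sum.distrib add_divide_distrib flip: sum_distrib_left)

lemma linear_deformation: "Vector_Spaces.linear (*s) (*s) (deformation e m n \<eta> \<kappa> \<epsilon>)"
  unfolding Vector_Spaces.linear_iff Finite_Cartesian_Product.vec_eq_iff
proof (intro conjI allI vec.vector_space_axioms)
  show "deformation e m n \<eta> \<kappa> \<epsilon> (M + N) $ x = (deformation e m n \<eta> \<kappa> \<epsilon> M + deformation e m n \<eta> \<kappa> \<epsilon> N) $ x" for M N x
    unfolding deformation_def diagonal_mean_linear
    by (simp add: entry_def distrib_left add_ac)
  show "deformation e m n \<eta> \<kappa> \<epsilon> (c *s M) $ x = (c *s deformation e m n \<eta> \<kappa> \<epsilon> M) $ x" for c M x
    unfolding deformation_def diagonal_mean_linear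
    by (simp add: entry_def distrib_left mult_ac)
qed

lemma sum_diagonals:
  "(\<Sum>\<sigma> | \<sigma> permutes I. \<Sum>i\<in>I. entry e M i (\<sigma> i)) = of_nat n * fact n * diagonal_mean e I M"
  unfolding diagonal_mean_def card_I using n(1) by simp

text \<open>Summing the block equations over all generalized diagonals gives
  \<open>n (s + \<epsilon> \<mu>) - m \<epsilon> \<mu> = 0\<close>. The corner equation removes the
  first term, so \<open>\<mu>\<close>, then \<open>s\<close>, then every block entry vanishes. It
  matters that the weights do not sum to 0.\<close>

lemma deformation_kernel:
  assumes \<kappa>\<epsilon>: "\<kappa> \<noteq> 0" "\<epsilon> \<noteq> 0" and zero: "deformation e m n \<eta> \<kappa> \<epsilon> M = 0"
  shows "M = 0"
proof -
  define s \<mu> where "s = entry e M 1 1" and "\<mu> = diagonal_mean e I M"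
  have entry0: "entry e (deformation e m n \<eta> \<kappa> \<epsilon> M) i j = 0" for i j
    by (simp add: zero entry_def)
  have corner: "s + \<epsilon> * \<mu> = 0"
    using entry0[of 1 1] \<kappa>\<epsilon> unfolding entry_deformation_corner s_def \<mu>_def by simp
  have block: "s + \<epsilon> * (entry e M i j + \<eta> i * \<mu>) = 0" if "i \<in> I" "j \<in> I" for i j
    using entry0[of i j] \<kappa>\<epsilon> entry_deformation_block[OF that] by (simp add: s_def \<mu>_def)
  have "0 = (\<Sum>\<sigma> | \<sigma> permutes I. \<Sum>i\<in>I. s + \<epsilon> * (entry e M i (\<sigma> i) + \<eta> i * \<mu>))"
    by (intro sum.neutral[symmetric] sum.neutral ballI block)
       (simp_all only: mem_Collect_eq permutes_in_image)
  also have "\<dots> = fact n * of_nat n * s + \<epsilon> * (of_nat n * fact n * \<mu>) + fact n * (\<epsilon> * ((\<Sum>i\<in>I. \<eta> i) * \<mu>))"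
    by (simp only: sum.distrib distrib_left sum_distrib_left[symmetric] sum_distrib_right[symmetric]
        sum_diagonals sum_constant card_I card_permutes_I of_nat_fact \<mu>_def) (simp only: ac_simps)
  also have "\<dots> = fact n * (of_nat n * (s + \<epsilon> * \<mu>) - of_nat m * (\<epsilon> * \<mu>))"
    by (simp only: sum_\<eta>) (simp add: algebra_simps)
  finally have "of_nat n * (s + \<epsilon> * \<mu>) - of_nat m * (\<epsilon> * \<mu>) = 0" by simp
  then have \<mu>: "\<mu> = 0" using \<kappa>\<epsilon> n by (simp add: corner)
  then have s: "s = 0" using corner by simp
  have "M $ x = 0" for x
  proof (cases "x \<in> map_prod e e ` S_index m n")
    case True
    then obtain i j where "x = (e i, e j)" "(i, j) = (1, 1) \<or> i \<in> I \<and> j \<in> I"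
      by (auto simp: S_index_def)
    then show ?thesis using s \<mu> block[of i j] \<kappa>\<epsilon> by (auto simp: s_def entry_def)
  next
    case False
    have "deformation e m n \<eta> \<kappa> \<epsilon> M $ x = 0" by (simp add: zero)
    with False show ?thesis by (simp add: deformation_def)
  qed
  then show ?thesis by (simp add: Finite_Cartesian_Product.vec_eq_iff)
qed

lemma bij_deformation:
  assumes "\<kappa> \<noteq> 0" "\<epsilon> \<noteq> 0"
  shows "bij (deformation e m n \<eta> \<kappa> \<epsilon>)"
proof -
  interpret h: Vector_Spaces.linear "(*s)" "(*s)" "deformation e m n \<eta> \<kappa> \<epsilon>"
    by (rule linear_deformation)
  have "inj (deformation e m n \<eta> \<kappa> \<epsilon>)"
  proof (rule injI)
    fix M N assume "deformation e m n \<eta> \<kappa> \<epsilon> M = deformation e m n \<eta> \<kappa> \<epsilon> N"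
    then have "deformation e m n \<eta> \<kappa> \<epsilon> (M - N) = 0" by (simp add: h.diff)
    then show "M = N" using deformation_kernel[OF assms] by fastforce
  qed
  then show ?thesis
    using vec.linear_inj_imp_surj[OF linear_deformation] by (simp add: bij_def)
qed

lemma deformation_outside:
  "x \<notin> map_prod e e ` S_index m n \<Longrightarrow> deformation e m n \<eta> \<kappa> \<epsilon> M $ x = M $ x"
  by (simp add: deformation_def)

text \<open>As \<open>act\<close> composes with inverses, the group element is the inverse of the
  deformation. Elements of \<open>S_perp\<close> are fixed because a matrix is altered only through
  its corner and block entries, which are zero there.\<close>

lemma padded_perm_deformation_in_orbit:
  assumes "\<kappa> \<noteq> 0" "\<epsilon> \<noteq> 0"
  shows "(\<lambda>M. padded_perm e m n (deformation e m n \<eta> \<kappa> \<epsilon> M))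
    \<in> (\<lambda>g. act g (padded_perm e m n)) ` L_P2 e m n"
proof -
  define h where "h = deformation e m n \<eta> \<kappa> \<epsilon>"
  have bij: "bij h" unfolding h_def by (rule bij_deformation[OF assms])
  have inv: "inv_into UNIV h (h M) = M" "h (inv_into UNIV h M) = M" for M
    using bij by (simp_all add: bij_is_inj bij_is_surj surj_f_inv_f)
  \<comment> \<open>Membership in \<open>S\<close> only concerns coordinates outside
    \<open>S_index\<close>, which the deformation leaves alone.\<close>
  have S: "M \<in> S_space e m n \<longleftrightarrow> h M \<in> S_space e m n" for M
    by (simp add: S_space_def span_matrix_unit h_def deformation_outside)
  have "inv_into UNIV h \<in> GL"
    unfolding GL_def using linear_inv_into[OF linear_deformation] bij
    by (auto simp: h_def intro: bij_imp_bij_inv)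
  moreover have "inv_into UNIV h ` S_space e m n = S_space e m n"
  proof
    show "inv_into UNIV h ` S_space e m n \<subseteq> S_space e m n"
      using S[of "inv_into UNIV h _"] inv(2) by auto
    show "S_space e m n \<subseteq> inv_into UNIV h ` S_space e m n"
      using S inv by (metis image_eqI subsetI)
  qed
  moreover have "inv_into UNIV h M = M" if M: "M \<in> S_perp e m n" for M
  proof -
    have M0: "M $ (e i, e j) = 0" if "(i, j) \<in> S_index m n" for i j
    proof -
      have ij: "i \<in> {1..m}" "j \<in> {1..m}" using that n by (auto simp: S_index_def)
      have "(e i, e j) \<notin> map_prod e e ` ({1..m} \<times> {1..m} - S_index m n)"
        using that e_eq_iff ij by auto
      then show ?thesis using M by (simp add: S_perp_def span_matrix_unit)
    qed
    have "entry e M 1 1 = 0" using M0[of 1 1] by (simp add: S_index_def entry_def)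
    moreover have "diagonal_mean e I M = 0"
    proof -
      have "entry e M i (\<sigma> i) = 0" if "\<sigma> permutes I" "i \<in> I" for \<sigma> i
        using that permutes_in_image[OF that(1), of i] M0[of i "\<sigma> i"] by (simp add: S_index_def entry_def)
      then show ?thesis by (simp add: diagonal_mean_def)
    qed
    moreover have "M $ x = 0" if "x \<in> map_prod e e ` S_index m n" for x
      using that M0 by auto
    ultimately have "h M = M"
      unfolding Finite_Cartesian_Product.vec_eq_iff h_def deformation_def by simp
    then show ?thesis using inv(1)[of M] by simp
  qed
  ultimately have "inv_into UNIV h \<in> L_P2 e m n" by (simp add: L_P2_def)
  moreover have "act (inv_into UNIV h) (padded_perm e m n) = (\<lambda>M. padded_perm e m n (h M))"
    using bij by (simp add: act_def inv_inv_eq)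
  ultimately show ?thesis unfolding h_def by (metis image_eqI)
qed

text \<open>Since \<open>\<kappa> ^ m\<close> takes every nonzero complex value, nonzero multiples
  of a point of the family stay in the family.\<close>

lemma padded_perm_deformation_scale:
  "padded_perm e m n (deformation e m n \<eta> \<kappa> \<epsilon> M) = \<kappa> ^ m * padded_perm e m n (deformation e m n \<eta> 1 \<epsilon> M)"
proof -
  have "permanent I (entry e (deformation e m n \<eta> \<kappa> \<epsilon> M))
      = \<kappa> ^ n * permanent I (entry e (deformation e m n \<eta> 1 \<epsilon> M))"
    unfolding permanent_def sum_distrib_left
  proof (intro sum.cong refl)
    fix \<sigma> assume "\<sigma> \<in> {\<sigma>. \<sigma> permutes I}"
    then have "\<sigma> i \<in> I" if "i \<in> I" for i using that by (simp only: mem_Collect_eq permutes_in_image)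
    then have "(\<Prod>i\<in>I. entry e (deformation e m n \<eta> \<kappa> \<epsilon> M) i (\<sigma> i))
        = (\<Prod>i\<in>I. \<kappa> * entry e (deformation e m n \<eta> 1 \<epsilon> M) i (\<sigma> i))"
      by (intro prod.cong refl) (simp only: entry_deformation_block mult_1)
    then show "(\<Prod>i\<in>I. entry e (deformation e m n \<eta> \<kappa> \<epsilon> M) i (\<sigma> i))
        = \<kappa> ^ n * (\<Prod>i\<in>I. entry e (deformation e m n \<eta> 1 \<epsilon> M) i (\<sigma> i))"
      by (simp only: prod.distrib prod_constant card_I)
  qed
  moreover have "\<kappa> ^ m = \<kappa> ^ (m - n) * \<kappa> ^ n" using n by (simp flip: power_add)
  ultimately show ?thesis
    unfolding padded_perm_def entry_deformation_corner[of \<kappa>] entry_deformation_corner[of 1]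
    by (simp add: power_mult_distrib mult_ac)
qed

section \<open>Expansion of the family in the deformation parameter\<close>

lemma coeff_prod_linear_low:
  assumes "finite A"
  shows "Polynomial.coeff (\<Prod>i\<in>A. [:s :: complex, x i:]) 0 = s ^ card A"
    and "Polynomial.coeff (\<Prod>i\<in>A. [:s, x i:]) 1 = s ^ (card A - 1) * (\<Sum>i\<in>A. x i)"
  using assms
proof (induction A)
  case (insert i A)
  \<comment> \<open>For \<open>card A = 0\<close> the truncated exponent is harmless, as the sum is
    empty.\<close>
  have "s * (s ^ (card A - 1) * (\<Sum>i\<in>A. x i)) = s ^ card A * (\<Sum>i\<in>A. x i)"
    using insert.hyps by (cases "card A") simp_all
  then show "Polynomial.coeff (\<Prod>i\<in>insert i A. [:s, x i:]) 0 = s ^ card (insert i A)"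
    "Polynomial.coeff (\<Prod>i\<in>insert i A. [:s, x i:]) 1 = s ^ (card (insert i A) - 1) * (\<Sum>i\<in>insert i A. x i)"
    using insert by (simp_all add: algebra_simps)
qed simp_all

text \<open>The weights \<open>\<eta>\<close> add up to \<open>- m\<close> precisely to make the first order term in \<open>\<epsilon>\<close> vanish.\<close>

lemma padded_perm_deformation_expansion:
  "\<exists>T. Polynomial.degree T \<le> m \<and> Polynomial.coeff T 1 = 0 \<and>
     (\<forall>\<epsilon>. poly T \<epsilon> = padded_perm e m n (deformation e m n \<eta> 1 \<epsilon> M))"
proof -
  define s \<mu> where "s = entry e M 1 1" and "\<mu> = diagonal_mean e I M"
  define r where "r = m - n"
  define T1 where "T1 = (\<Prod>i<r. [:s, \<mu>:])"
  define T2 where "T2 = (\<Sum>\<sigma> | \<sigma> permutes I. \<Prod>i\<in>I. [:s, entry e M i (\<sigma> i) + \<eta> i * \<mu>:])"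
  have r: "r + n = m" "r > 0" using n by (simp_all add: r_def)
  have prod_deg: "Polynomial.degree (\<Prod>i\<in>A. [:s, x i:]) \<le> card A" if "finite A" for A :: "nat set" and x
  proof -
    have "Polynomial.degree (\<Prod>i\<in>A. [:s, x i:]) \<le> (\<Sum>i\<in>A. Polynomial.degree [:s, x i:])"
      using that by (rule degree_prod_sum_le[unfolded o_def])
    also have "\<dots> \<le> (\<Sum>i\<in>A. 1)" by (intro sum_mono) simp
    finally show ?thesis by simp
  qed
  have deg1: "Polynomial.degree T1 \<le> r" unfolding T1_def using prod_deg[of "{..<r}" "\<lambda>_. \<mu>"] by simp
  have deg2: "Polynomial.degree T2 \<le> n"
    unfolding T2_def
  proof (intro degree_sum_le finite_permutations finite_atLeastAtMost)
    show "Polynomial.degree (\<Prod>i\<in>I. [:s, entry e M i (\<sigma> i) + \<eta> i * \<mu>:]) \<le> n" for \<sigma>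
      by (rule order.trans[OF prod_deg]) (simp_all only: card_I order_refl finite_atLeastAtMost)
  qed
  have "Polynomial.degree (T1 * T2) \<le> m"
    using degree_mult_le[of T1 T2] deg1 deg2 r by linarith
  moreover have "Polynomial.coeff (T1 * T2) 1 = 0"
  proof -
    have c1: "Polynomial.coeff T1 0 = s ^ r" "Polynomial.coeff T1 1 = s ^ (r - 1) * (of_nat r * \<mu>)"
      unfolding T1_def by (simp_all only: coeff_prod_linear_low[OF finite_lessThan] card_lessThan sum_constant)
    have c20: "Polynomial.coeff T2 0 = fact n * s ^ n"
      unfolding T2_def coeff_sum
      by (simp only: coeff_prod_linear_low[OF finite_atLeastAtMost] card_I sum_constant card_permutes_I of_nat_fact)
    have "Polynomial.coeff T2 1 = (\<Sum>\<sigma> | \<sigma> permutes I. s ^ (n - 1) * (\<Sum>i\<in>I. entry e M i (\<sigma> i) + \<eta> i * \<mu>))"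
      unfolding T2_def coeff_sum
      by (simp only: coeff_prod_linear_low[OF finite_atLeastAtMost] card_I)
    also have "\<dots> = s ^ (n - 1) * (of_nat n * fact n * \<mu> - fact n * (of_nat m * \<mu>))"
      by (simp only: sum.distrib sum_distrib_left[symmetric] sum_distrib_right[symmetric] sum_diagonals
          sum_constant card_permutes_I sum_\<eta> \<mu>_def[symmetric] of_nat_fact) simp
    finally have c21: "Polynomial.coeff T2 1 = s ^ (n - 1) * (of_nat n * fact n * \<mu> - fact n * (of_nat m * \<mu>))" .
    \<comment> \<open>Relative to \<open>s ^ (m - 1) * fact n * \<mu>\<close>, the padding
      contributes \<open>r\<close>, the block entries \<open>n\<close> and the weights
      \<open>- m\<close>.\<close>
    have "Polynomial.coeff (T1 * T2) 1 = s ^ r * (s ^ (n - 1) * (of_nat n * fact n * \<mu> - fact n * (of_nat m * \<mu>)))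
        + s ^ (r - 1) * (of_nat r * \<mu>) * (fact n * s ^ n)"
      by (simp add: coeff_mult c1[simplified] c20 c21[simplified])
    also have "s ^ (r - 1) * (of_nat r * \<mu>) * (fact n * s ^ n) = s ^ (r - 1 + n) * fact n * (of_nat r * \<mu>)"
      by (simp add: power_add)
    also have "r - 1 + n = r + (n - 1)" using r(2) n(1) by simp
    also have "s ^ r * (s ^ (n - 1) * (of_nat n * fact n * \<mu> - fact n * (of_nat m * \<mu>)))
        + s ^ (r + (n - 1)) * fact n * (of_nat r * \<mu>) = s ^ (r + (n - 1)) * fact n * \<mu> * (of_nat n - of_nat m + of_nat r)"
      by (simp add: power_add algebra_simps)
    also have "\<dots> = 0" by (simp add: r(1)[symmetric])
    finally show ?thesis .
  qed
  moreover have "poly (T1 * T2) \<epsilon> = padded_perm e m n (deformation e m n \<eta> 1 \<epsilon> M)" for \<epsilon>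
  proof -
    have "permanent I (entry e (deformation e m n \<eta> 1 \<epsilon> M)) = poly T2 \<epsilon>"
      unfolding permanent_def T2_def poly_sum poly_prod
    proof (intro sum.cong prod.cong refl)
      fix \<sigma> i assume "\<sigma> \<in> {\<sigma>. \<sigma> permutes I}" "i \<in> I"
      then have "\<sigma> i \<in> I" by (simp only: mem_Collect_eq permutes_in_image)
      with \<open>i \<in> I\<close> show "entry e (deformation e m n \<eta> 1 \<epsilon> M) i (\<sigma> i) = poly [:s, entry e M i (\<sigma> i) + \<eta> i * \<mu>:] \<epsilon>"
        by (simp only: entry_deformation_block) (simp add: s_def \<mu>_def)
    qed
    then show ?thesis
      unfolding padded_perm_def entry_deformation_corner
      by (simp add: T1_def poly_prod s_def \<mu>_def r_def)
  qed
  ultimately show ?thesis by blast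
qed

text \<open>Direction and base point of the test line. The block is constant along it, so the
  deformed entries depend only on their row and the permanent collapses to \<open>n!\<close> times a
  product of linear factors with visible roots.\<close>

definition "corner = (matrix_unit e (1, 1) :: 'm endo)"
definition "ones_block = ((\<chi> x. if x \<in> map_prod e e ` (I \<times> I) then 1 else 0) :: 'm endo)"

lemma line_values:
  shows "entry e (x *s corner + ones_block) 1 1 = x"
    and "i \<in> I \<Longrightarrow> j \<in> I \<Longrightarrow> entry e (x *s corner + ones_block) i j = 1"
    and "diagonal_mean e I (x *s corner + ones_block) = 1"
proof -
  have e1: "e i \<noteq> e 1" if "i \<in> I" for i using that n e_eq_iff[of i 1] by auto
  show "entry e (x *s corner + ones_block) 1 1 = x"
    using e1 by (force simp: entry_def corner_def ones_block_def matrix_unit_def axis_def)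
  have block: "entry e (x *s corner + ones_block) i j = 1" if "i \<in> I" "j \<in> I" for i j
    using that e1[OF that(1)] by (force simp: entry_def corner_def ones_block_def matrix_unit_def axis_def)
  then show "i \<in> I \<Longrightarrow> j \<in> I \<Longrightarrow> entry e (x *s corner + ones_block) i j = 1" .
  have "(\<Sum>\<sigma> | \<sigma> permutes I. \<Sum>i\<in>I. entry e (x *s corner + ones_block) i (\<sigma> i))
      = (\<Sum>\<sigma> | \<sigma> permutes I. \<Sum>i\<in>I. 1)"
    by (intro sum.cong refl block) (simp_all only: mem_Collect_eq permutes_in_image)
  also have "\<dots> = of_nat n * fact n"
    by (simp only: sum_constant card_I card_permutes_I of_nat_fact) simp
  finally show "diagonal_mean e I (x *s corner + ones_block) = 1"
    unfolding diagonal_mean_def card_I using n(1) by simp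
qed

lemma padded_perm_deformation_on_line:
  "padded_perm e m n (deformation e m n \<eta> \<kappa> \<epsilon> (x *s corner + ones_block))
    = poly (Polynomial.smult (\<kappa> ^ m * fact n) ([:\<epsilon>, 1:] ^ (m - n) * (\<Prod>i\<in>I. [:\<epsilon> * (1 + \<eta> i), 1:]))) x"
proof -
  have "permanent I (entry e (deformation e m n \<eta> 1 \<epsilon> (x *s corner + ones_block)))
      = (\<Sum>\<sigma> | \<sigma> permutes I. \<Prod>i\<in>I. x + \<epsilon> * (1 + \<eta> i))"
    unfolding permanent_def
  proof (intro sum.cong prod.cong refl)
    fix \<sigma> i assume "\<sigma> \<in> {\<sigma>. \<sigma> permutes I}" "i \<in> I"
    then have "\<sigma> i \<in> I" by (simp only: mem_Collect_eq permutes_in_image)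
    with \<open>i \<in> I\<close> show "entry e (deformation e m n \<eta> 1 \<epsilon> (x *s corner + ones_block)) i (\<sigma> i) = x + \<epsilon> * (1 + \<eta> i)"
      by (simp only: entry_deformation_block line_values mult_1 mult_1_right)
  qed
  also have "\<dots> = fact n * (\<Prod>i\<in>I. x + \<epsilon> * (1 + \<eta> i))"
    by (simp only: sum_constant card_permutes_I of_nat_fact)
  finally have "padded_perm e m n (deformation e m n \<eta> 1 \<epsilon> (x *s corner + ones_block))
      = (x + \<epsilon>) ^ (m - n) * (fact n * (\<Prod>i\<in>I. x + \<epsilon> * (1 + \<eta> i)))"
    unfolding padded_perm_def entry_deformation_corner line_values by simp
  then show ?thesis
    unfolding padded_perm_deformation_scale[of \<kappa>]
    by (simp add: poly_prod ac_simps)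
qed

text \<open>The roots are \<open>- \<epsilon>\<close>, from the padding, and
  \<open>- \<epsilon> (1 + \<eta> i)\<close>. Nonzero weights separate the latter from the former,
  injectivity separates them from each other.\<close>

lemma deformation_line_roots:
  assumes "\<kappa> \<noteq> 0" "\<epsilon> \<noteq> 0" and \<eta>: "inj_on \<eta> I" "\<forall>i\<in>I. \<eta> i \<noteq> 0"
  defines "P \<equiv> Polynomial.smult (\<kappa> ^ m * fact n) ([:\<epsilon>, 1:] ^ (m - n) * (\<Prod>i\<in>I. [:\<epsilon> * (1 + \<eta> i), 1:]))"
  shows "Polynomial.coeff P m = \<kappa> ^ m * fact n" "card {x. poly P x = 0} = Suc n"
proof -
  define R where "R = [:\<epsilon>, 1:] ^ (m - n) * (\<Prod>i\<in>I. [:\<epsilon> * (1 + \<eta> i), 1:])"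
  have "Polynomial.degree (\<Prod>i\<in>I. [:\<epsilon> * (1 + \<eta> i), 1:]) = n"
    by (subst degree_prod_eq_sum_degree) (use n in auto)
  then have "Polynomial.degree R = m"
    using n unfolding R_def by (subst degree_mult_eq) (auto simp: degree_power_eq)
  moreover have "Polynomial.lead_coeff R = 1"
    unfolding R_def by (simp only: lead_coeff_mult lead_coeff_power lead_coeff_prod) simp
  ultimately show "Polynomial.coeff P m = \<kappa> ^ m * fact n" unfolding P_def R_def[symmetric] by simp
  have "{x. poly P x = 0} = insert (- \<epsilon>) ((\<lambda>i. - (\<epsilon> * (1 + \<eta> i))) ` I)"
    using assms(1) n by (auto simp: P_def poly_prod eq_neg_iff_add_eq_0 add.commute)
  moreover have "inj_on (\<lambda>i. - (\<epsilon> * (1 + \<eta> i))) I"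
    using \<eta>(1) assms(2) by (auto simp: inj_on_def)
  moreover have "- \<epsilon> \<notin> (\<lambda>i. - (\<epsilon> * (1 + \<eta> i))) ` I"
    using \<eta>(2) assms(2) by auto
  ultimately show "card {x. poly P x = 0} = Suc n" using n by (simp add: card_image)
qed

end

section \<open>Choice of the weights and the contradiction\<close>

lemma distinct_nonzero_weights:
  assumes "0 < n" "n \<le> m"
  shows "\<exists>\<eta> :: nat \<Rightarrow> complex. inj_on \<eta> {m - n + 1..m} \<and> (\<forall>i\<in>{m - n + 1..m}. \<eta> i \<noteq> 0) \<and>
    (\<Sum>i=m - n + 1..m. \<eta> i) = - of_nat m"
proof -
  define c :: complex where "c = of_nat (\<Sum>i=m - n + 1..m. i)"
  have "m \<in> {m - n + 1..m}" using assms by simp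
  then have c: "c \<noteq> 0" using assms unfolding c_def of_nat_eq_0_iff by (subst sum_eq_0_iff) auto
  show ?thesis
  \<comment> \<open>Proportional to the index, hence distinct and nonzero, and normalized to the
    prescribed sum.\<close>
  proof (intro exI[of _ "\<lambda>i. - of_nat m * of_nat i / c"] conjI)
    have "(\<Sum>i=m - n + 1..m. - of_nat m * of_nat i / c) = - of_nat m * c / c"
      unfolding c_def of_nat_sum by (simp only: sum_distrib_left sum_divide_distrib)
    then show "(\<Sum>i=m - n + 1..m. - of_nat m * of_nat i / c) = - of_nat m" using c by simp
  qed (use c assms in \<open>auto simp: inj_on_def\<close>)
qed

theorem corollary8p3:
  fixes e :: "nat \<Rightarrow> 'm::finite" and m n :: nat
  assumes "CARD('m) = m" and "bij_betw e {1..m} (UNIV :: 'm set)"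
    and "n \<ge> 3" and "m \<ge> 2 * n"
  shows "\<not> normal_affine_variety (forms m) (orbit_closure e m n)"
proof
  assume normal: "normal_affine_variety (forms m) (orbit_closure e m n)"
  have n: "n > 0" "n < m" "n \<le> m" "m - n \<ge> 2" using assms(3,4) by auto
  obtain \<eta> :: "nat \<Rightarrow> complex" where \<eta>: "inj_on \<eta> {m - n + 1..m}"
    "\<forall>i\<in>{m - n + 1..m}. \<eta> i \<noteq> 0" "(\<Sum>i=m - n + 1..m. \<eta> i) = - of_nat m"
    using distinct_nonzero_weights[OF n(1,3)] by (elim exE conjE)
  note base = assms(2) n(1,2) \<eta>(3)
  define h where "h = deformation e m n \<eta>"
  define w where "w = (\<lambda>\<kappa> \<epsilon> M. padded_perm e m n (h \<kappa> \<epsilon> M))"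
  define B where "B = (\<lambda>g. act g (padded_perm e m n)) ` L_P2 e m n"
  define u v where "u = corner e" and "v = ones_block e m n"
  define P where "P = (\<lambda>\<kappa> \<epsilon>. Polynomial.smult (\<kappa> ^ m * fact n)
    ([:\<epsilon>, 1:] ^ (m - n) * (\<Prod>i\<in>{m - n + 1..m}. [:\<epsilon> * (1 + \<eta> i), 1:])))"
  have linear: "Vector_Spaces.linear (*s) (*s) (h \<kappa> \<epsilon>)" for \<kappa> \<epsilon>
    unfolding h_def by (rule linear_deformation[OF base])
  have wB: "w \<kappa> \<epsilon> \<in> B" if "\<kappa> \<noteq> 0" "\<epsilon> \<noteq> 0" for \<kappa> \<epsilon>
    unfolding w_def B_def h_def by (rule padded_perm_deformation_in_orbit[OF base that])
  have wP: "poly (P \<kappa> \<epsilon>) x = w \<kappa> \<epsilon> (x *s u + v)" for \<kappa> \<epsilon> x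
    unfolding w_def h_def P_def u_def v_def by (rule padded_perm_deformation_on_line[OF base, symmetric])
  have P: "Polynomial.coeff (P \<kappa> \<epsilon>) m = \<kappa> ^ m * fact n" "card {x. poly (P \<kappa> \<epsilon>) x = 0} = Suc n"
    if "\<kappa> \<noteq> 0" "\<epsilon> \<noteq> 0" for \<kappa> \<epsilon>
    unfolding P_def using deformation_line_roots[OF base that \<eta>(1,2)] .
  have B: "\<exists>h. Vector_Spaces.linear (*s) (*s) h \<and> b = (\<lambda>M. padded_perm e m n (h M))" if b: "b \<in> B" for b
  proof -
    obtain g where "b = act g (padded_perm e m n)" "g \<in> L_P2 e m n"
      using b unfolding B_def by (rule imageE)
    then show ?thesis
      by (intro exI[of _ "inv_into UNIV g"]) (auto simp: L_P2_def GL_def act_def intro: linear_inv_into)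
  qed
  have "\<exists>H\<in>polynomial_functions (forms m). \<forall>h P. Vector_Spaces.linear (*s) (*s) h \<longrightarrow>
    (\<lambda>M. padded_perm e m n (h M)) \<in> B \<longrightarrow> (\<forall>x. poly P x = padded_perm e m n (h (x *s u + v))) \<longrightarrow>
    Polynomial.coeff P m \<noteq> 0 \<longrightarrow> card {x. poly P x = 0} = Suc n \<longrightarrow>
    H (\<lambda>M. padded_perm e m n (h M))
      = - (Polynomial.coeff P m * entry e (h v) 1 1 / entry e (h u) 1 1)"
    using normal_imp_root_polynomial[of m B n e "w 1 1" "P 1 1" u v]
      normal[unfolded orbit_closure_def, folded B_def] n B wB wP P[of 1 1] by simp
  then obtain H where H: "H \<in> polynomial_functions (forms m)"
    "\<forall>h P. Vector_Spaces.linear (*s) (*s) h \<longrightarrow>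
    (\<lambda>M. padded_perm e m n (h M)) \<in> B \<longrightarrow> (\<forall>x. poly P x = padded_perm e m n (h (x *s u + v))) \<longrightarrow>
    Polynomial.coeff P m \<noteq> 0 \<longrightarrow> card {x. poly P x = 0} = Suc n \<longrightarrow>
    H (\<lambda>M. padded_perm e m n (h M))
      = - (Polynomial.coeff P m * entry e (h v) 1 1 / entry e (h u) 1 1)"
    by (rule bexE)
  have Hw: "H (w \<kappa> \<epsilon>) = \<kappa> ^ m * (- fact n * \<epsilon>)" if "\<kappa> \<noteq> 0" "\<epsilon> \<noteq> 0" for \<kappa> \<epsilon>
  proof -
    have v: "entry e v 1 1 = 0" "diagonal_mean e {m - n + 1..m} v = 1"
      using line_values(1,3)[OF base, of 0] by (simp_all add: u_def v_def)
    \<comment> \<open>The values at \<open>u\<close> are differences of those at the points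
      \<open>x = 1\<close> and \<open>x = 0\<close> of the line.\<close>
    have "1 *s u + v = u + v" by simp
    then have "entry e (u + v) 1 1 = 1" "diagonal_mean e {m - n + 1..m} (u + v) = 1"
      using line_values(1,3)[OF base, of 1] by (simp_all add: u_def v_def)
    then have u: "entry e u 1 1 = 1" "diagonal_mean e {m - n + 1..m} u = 0"
      using v unfolding diagonal_mean_linear[OF base] by (simp_all add: entry_def)
    \<comment> \<open>So the root is \<open>- \<epsilon>\<close> whatever \<open>\<kappa>\<close>
      is; \<open>\<kappa> ^ m\<close> enters through the leading coefficient alone.\<close>
    have "entry e (h \<kappa> \<epsilon> u) 1 1 = \<kappa>" "entry e (h \<kappa> \<epsilon> v) 1 1 = \<kappa> * \<epsilon>"
      unfolding h_def entry_deformation_corner[OF base] u v by simp_all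
    then show ?thesis
      using H(2)[rule_format, OF linear wB[OF that, unfolded w_def], of "P \<kappa> \<epsilon>"] wP[of \<kappa> \<epsilon>, unfolded w_def]
        P[OF that] that by (simp add: w_def)
  qed
  obtain \<phi> where \<phi>: "linear_form_on (forms m) \<phi>"
    "\<forall>b\<in>forms m. \<forall>y. (\<forall>t. t \<noteq> 0 \<longrightarrow> H (\<lambda>M. t * b M) = t * y) \<longrightarrow> \<phi> b = y"
    using linear_form_of_homogeneous_values[OF H(1)] by (elim exE conjE)
  have w_forms: "w 1 \<epsilon> \<in> forms m" for \<epsilon>
    unfolding w_def by (rule padded_perm_linear_in_forms[OF linear n(3)])
  have \<phi>w: "\<phi> (w 1 \<epsilon>) = - fact n * \<epsilon>" if "\<epsilon> \<noteq> 0" for \<epsilon>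
  proof (rule \<phi>(2)[rule_format, OF w_forms])
    fix t :: complex assume "t \<noteq> 0"
    then obtain \<kappa> where \<kappa>: "\<kappa> \<noteq> 0" "t = \<kappa> ^ m"
      using exists_complex_root_nonzero[of t m] n by auto
    have "(\<lambda>M. t * w 1 \<epsilon> M) = w \<kappa> \<epsilon>"
      unfolding w_def h_def \<kappa>(2) padded_perm_deformation_scale[OF base, of \<kappa>] ..
    then show "H (\<lambda>M. t * w 1 \<epsilon> M) = t * (- fact n * \<epsilon>)"
      using Hw[OF \<kappa>(1) that] \<kappa>(2) by simp
  qed
  \<comment> \<open>The nodes start at 1 because \<open>\<phi> (w 1 \<epsilon>)\<close> is known
    only for nonzero \<open>\<epsilon>\<close>.\<close>
  define \<epsilon> :: "nat \<Rightarrow> complex" where "\<epsilon> = (\<lambda>j. of_nat (Suc j))"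
  have \<epsilon>: "inj_on \<epsilon> {..m}" "\<epsilon> j \<noteq> 0" for j by (simp_all add: \<epsilon>_def inj_on_def del: of_nat_Suc)
  from coefficient_functional[OF \<epsilon>(1)] obtain \<Lambda> where \<Lambda>: "\<forall>T i. Polynomial.degree T \<le> m \<longrightarrow>
      (\<Sum>j\<le>m. \<Lambda> i j * poly T (\<epsilon> j)) = Polynomial.coeff T i" ..
  \<comment> \<open>\<open>\<Lambda> 1\<close> extracts the first order coefficient in
    \<open>\<epsilon>\<close>; its vanishing at every \<open>M\<close> is a linear relation between
    forms, to which \<open>\<phi>\<close> applies.\<close>
  have vanish: "(\<Sum>j\<le>m. \<Lambda> 1 j * w 1 (\<epsilon> j) M) = 0" for M
  proof -
    obtain T where T: "Polynomial.degree T \<le> m" "Polynomial.coeff T 1 = 0"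
      "\<And>\<epsilon>. poly T \<epsilon> = padded_perm e m n (deformation e m n \<eta> 1 \<epsilon> M)"
      using padded_perm_deformation_expansion[OF base] by blast
    show ?thesis using \<Lambda>[rule_format, OF T(1), of 1] T(2,3) by (simp add: w_def h_def)
  qed
  have "func.subspace (forms m :: ('m endo \<Rightarrow> complex) set)"
    unfolding forms_def by (rule func.subspace_span)
  note form_sum = linear_form_on_sum[OF \<phi>(1) this, THEN conjunct1]
  have "(\<Sum>j\<le>m. \<Lambda> 1 j * \<phi> (w 1 (\<epsilon> j))) = \<phi> (\<lambda>M. \<Sum>j\<le>m. \<Lambda> 1 j * w 1 (\<epsilon> j) M)"
    by (rule form_sum[symmetric]) (rule w_forms)
  also have "\<dots> = \<phi> (\<lambda>M. \<Sum>j\<in>{}. \<Lambda> 1 j * w 1 (\<epsilon> j) M)" by (simp only: vanish sum.empty)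
  also have "\<dots> = 0" by (subst form_sum) simp_all
  finally have "(\<Sum>j\<le>m. \<Lambda> 1 j * poly [:0, - fact n:] (\<epsilon> j)) = 0"
    using \<epsilon>(2) by (simp add: \<phi>w mult.commute)
  \<comment> \<open>The same functional applied to the values of \<open>\<phi>\<close> reads off the
    linear coefficient of \<open>- fact n * \<epsilon>\<close>.\<close>
  moreover have "(\<Sum>j\<le>m. \<Lambda> 1 j * poly [:0, - fact n:] (\<epsilon> j)) = - fact n"
    using \<Lambda>[rule_format, of "[:0, - fact n:]" 1] n by simp
  ultimately show False by simp
qed

end
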